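(* For every positive integer $m$ there exists a finite-dimensional complete Lie algebra $\mathfrak{g}$ over $\mathbb{C}$ whose nilradical is quasi-filiform and such that $\dim H^{2}(\mathfrak{g},\mathfrak{g})\geq m$.
   Context: All Lie algebras are finite-dimensional over $\mathbb{C}$. A Lie algebra $\mathfrak{g}$ is complete if its center is zero and every derivation of $\mathfrak{g}$ is inner, i.e. $Z(\mathfrak{g})=\{0\}$ and $\mathrm{Der}(\mathfrak{g})=\mathrm{ad}(\mathfrak{g})$. For a nilpotent Lie algebra $\mathfrak{n}$, put $\mathfrak{n}_1=\mathfrak{n}$ and $\mathfrak{n}_{k+1}=[\mathfrak{n}_k,\mathfrak{n}]$. The nilindex of $\mathfrak{n}$ is the integer $p$ with $\mathfrak{n}_{p}\neq\{0\}$ and $\mathfrak{n}_{p+1}=\{0\}$. A nilpotent Lie algebra of dimension $n$ is called quasi-filiform if its nilindex equals $n-2$. $H^{2}(\mathfrak{g},\mathfrak{g})$ denotes the second Chevalley–Eilenberg cohomology group of $\mathfrak{g}$ with values in the adjoint module. *)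

theory Defs
  imports Complex_Main "HOL-Library.Function_Algebras" "HOL-Library.Set_Algebras"
begin

definition quotient_space :: "'v::ab_group_add set \<Rightarrow> 'v set \<Rightarrow> 'v set set" where
  "quotient_space V W = (\<lambda>v. v +o W) ` V"

text \<open>
  The linear combination of the cosets \<open>X \<in> S\<close> with coefficients \<open>c X\<close>, formed with the
  Minkowski sum of sets. The summand \<open>W\<close> (the zero vector of the quotient) only matters if
  \<open>S\<close> is empty or all coefficients vanish; see \<open>coset_comb_eq\<close> below.
\<close>

definition coset_comb ::
  "('k::field \<Rightarrow> 'v::ab_group_add \<Rightarrow> 'v) \<Rightarrow> 'v set \<Rightarrow> 'v set set \<Rightarrow> ('v set \<Rightarrow> 'k) \<Rightarrow> 'v set" where
  "coset_comb s W S c = (\<Sum>X\<in>S. s (c X) ` X) + W"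

definition coset_basis ::
  "('k::field \<Rightarrow> 'v::ab_group_add \<Rightarrow> 'v) \<Rightarrow> 'v set \<Rightarrow> 'v set set \<Rightarrow> 'v set set \<Rightarrow> bool" where
  "coset_basis s W Q S \<longleftrightarrow>
     finite S \<and> S \<subseteq> Q \<and>
     (\<forall>c. coset_comb s W S c = W \<longrightarrow> (\<forall>X\<in>S. c X = 0)) \<and>
     (\<forall>X\<in>Q. \<exists>c. X = coset_comb s W S c)"

text \<open>
  The dimension of a space \<open>Q\<close> of cosets of \<open>W\<close>; as for \<^const>\<open>vector_space.dim\<close>, it is \<open>0\<close>
  if there is no finite basis.
\<close>

definition coset_dim ::
  "('k::field \<Rightarrow> 'v::ab_group_add \<Rightarrow> 'v) \<Rightarrow> 'v set \<Rightarrow> 'v set set \<Rightarrow> nat" where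
  "coset_dim s W Q =
     (if \<exists>S. coset_basis s W Q S then card (SOME S. coset_basis s W Q S) else 0)"

text \<open>
  The underlying space of a Lie algebra is a subspace \<open>L\<close> of an ambient vector space; the bracket
  is a total function whose values outside \<open>L\<close> are irrelevant.
\<close>

definition linear_on ::
  "('k::field \<Rightarrow> 'v::ab_group_add \<Rightarrow> 'v) \<Rightarrow> 'v set \<Rightarrow> ('v \<Rightarrow> 'v) \<Rightarrow> bool" where
  "linear_on s L f \<longleftrightarrow>
     (\<forall>x\<in>L. \<forall>y\<in>L. f (x + y) = f x + f y) \<and> (\<forall>c. \<forall>x\<in>L. f (s c x) = s c (f x))"

definition bilinear_on ::
  "('k::field \<Rightarrow> 'v::ab_group_add \<Rightarrow> 'v) \<Rightarrow> 'v set \<Rightarrow> ('v \<Rightarrow> 'v \<Rightarrow> 'v) \<Rightarrow> bool" where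
  "bilinear_on s L f \<longleftrightarrow>
     (\<forall>x\<in>L. linear_on s L (f x)) \<and> (\<forall>y\<in>L. linear_on s L (\<lambda>x. f x y))"

locale lie_algebra = vector_space scale
  for scale :: "'k::field \<Rightarrow> 'v::ab_group_add \<Rightarrow> 'v" (infixr "*s" 75) +
  fixes L :: "'v set"
    and br :: "'v \<Rightarrow> 'v \<Rightarrow> 'v"
  assumes subspace_L: "subspace L"
    and br_closed: "x \<in> L \<Longrightarrow> y \<in> L \<Longrightarrow> br x y \<in> L"
    and br_bilinear: "bilinear_on scale L br"
    and br_self: "x \<in> L \<Longrightarrow> br x x = 0"
    and jacobi: "x \<in> L \<Longrightarrow> y \<in> L \<Longrightarrow> z \<in> L \<Longrightarrow>
      br x (br y z) + br y (br z x) + br z (br x y) = 0"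
begin

definition finite_dim :: bool where
  "finite_dim \<longleftrightarrow> (\<exists>B. finite B \<and> L = span B)"

definition center :: "'v set" where
  "center = {x \<in> L. \<forall>y\<in>L. br x y = 0}"

definition bracket_space :: "'v set \<Rightarrow> 'v set \<Rightarrow> 'v set" where
  "bracket_space A B = span {br x y | x y. x \<in> A \<and> y \<in> B}"

text \<open>The lower central series starts at index \<open>1\<close>; index \<open>0\<close> is a dummy repeating \<open>L\<close>,
  for which \<open>has_nilindex 0\<close> is never true.\<close>

primrec lower_central :: "nat \<Rightarrow> 'v set" where
  "lower_central 0 = L"
| "lower_central (Suc k) = (if k = 0 then L else bracket_space (lower_central k) L)"

definition nilpotent :: bool where
  "nilpotent \<longleftrightarrow> (\<exists>k. lower_central k = {0})"

definition has_nilindex :: "nat \<Rightarrow> bool" where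
  "has_nilindex p \<longleftrightarrow> lower_central p \<noteq> {0} \<and> lower_central (p + 1) = {0}"

definition quasi_filiform :: bool where
  "quasi_filiform \<longleftrightarrow> finite_dim \<and> nilpotent \<and> (\<exists>p. has_nilindex p \<and> dim L = p + 2)"

definition lie_ideal :: "'v set \<Rightarrow> bool" where
  "lie_ideal I \<longleftrightarrow> subspace I \<and> I \<subseteq> L \<and> (\<forall>x\<in>L. \<forall>y\<in>I. br x y \<in> I)"

text \<open>
  Cochains are extended by \<open>0\<close> outside \<open>L\<close>, so that they are determined by their values on \<open>L\<close>
  and form a subspace of a function space.
\<close>

definition cochains1 :: "('v \<Rightarrow> 'v) set" where
  "cochains1 = {f. linear_on scale L f \<and> (\<forall>x\<in>L. f x \<in> L) \<and> (\<forall>x. x \<notin> L \<longrightarrow> f x = 0)}"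

definition cochains2 :: "('v \<Rightarrow> 'v \<Rightarrow> 'v) set" where
  "cochains2 = {\<omega>. bilinear_on scale L \<omega> \<and> (\<forall>x\<in>L. \<omega> x x = 0) \<and>
     (\<forall>x\<in>L. \<forall>y\<in>L. \<omega> x y \<in> L) \<and> (\<forall>x y. x \<notin> L \<or> y \<notin> L \<longrightarrow> \<omega> x y = 0)}"

definition d1 :: "('v \<Rightarrow> 'v) \<Rightarrow> 'v \<Rightarrow> 'v \<Rightarrow> 'v" where
  "d1 f = (\<lambda>x y. if x \<in> L \<and> y \<in> L then br x (f y) - br y (f x) - f (br x y) else 0)"

definition d2 :: "('v \<Rightarrow> 'v \<Rightarrow> 'v) \<Rightarrow> 'v \<Rightarrow> 'v \<Rightarrow> 'v \<Rightarrow> 'v" where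
  "d2 \<omega> = (\<lambda>x y z. if x \<in> L \<and> y \<in> L \<and> z \<in> L then
       br x (\<omega> y z) - br y (\<omega> x z) + br z (\<omega> x y)
       - \<omega> (br x y) z + \<omega> (br x z) y - \<omega> (br y z) x
     else 0)"

definition cocycles2 :: "('v \<Rightarrow> 'v \<Rightarrow> 'v) set" where
  "cocycles2 = {\<omega> \<in> cochains2. d2 \<omega> = 0}"

definition coboundaries2 :: "('v \<Rightarrow> 'v \<Rightarrow> 'v) set" where
  "coboundaries2 = d1 ` cochains1"

definition cochain_scale :: "'k \<Rightarrow> ('v \<Rightarrow> 'v \<Rightarrow> 'v) \<Rightarrow> 'v \<Rightarrow> 'v \<Rightarrow> 'v" where
  "cochain_scale c \<omega> = (\<lambda>x y. c *s \<omega> x y)"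

definition H2 :: "('v \<Rightarrow> 'v \<Rightarrow> 'v) set set" where
  "H2 = quotient_space cocycles2 coboundaries2"

definition dim_H2 :: nat where
  "dim_H2 = coset_dim cochain_scale coboundaries2 H2"

definition derivations :: "('v \<Rightarrow> 'v) set" where
  "derivations = {D \<in> cochains1. \<forall>x\<in>L. \<forall>y\<in>L. D (br x y) = br (D x) y + br x (D y)}"

definition ad :: "'v \<Rightarrow> 'v \<Rightarrow> 'v" where
  "ad x = (\<lambda>y. if y \<in> L then br x y else 0)"

definition complete_lie :: bool where
  "complete_lie \<longleftrightarrow> center = {0} \<and> derivations = ad ` L"

end

text \<open>
  The nilradical is the sum of all nilpotent ideals, where an ideal is regarded as a Lie algebra
  with the restricted bracket. In finite dimension it is the largest nilpotent ideal.
\<close>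

definition (in lie_algebra) nilradical :: "'v set" where
  "nilradical = span (\<Union>{I. lie_ideal I \<and> lie_algebra.nilpotent scale I br})"

context vector_space
begin

lemma sum_cosets:
  assumes W: "subspace W" and fin: "finite S"
  shows "(\<Sum>X\<in>S. scale (c X) ` (r X +o W)) + W = (\<Sum>X\<in>S. c X *s r X) +o W"
  using fin
proof (induction S rule: finite_induct)
  case empty
  then show ?case by (simp add: set_plus_def)
next
  case (insert X S)
  have "scale (c X) ` (r X +o W) + (a +o W) = (c X *s r X + a) +o W" for a
  proof (rule set_eqI, rule iffI)
    fix z assume "z \<in> scale (c X) ` (r X +o W) + (a +o W)"
    then obtain w w' where w: "w \<in> W" "w' \<in> W" and "z = c X *s (r X + w) + (a + w')"
      by (auto simp: set_plus_def elt_set_plus_def)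
    then have "z = (c X *s r X + a) + (c X *s w + w')"
      by (simp add: scale_right_distrib algebra_simps)
    moreover have "c X *s w + w' \<in> W"
      using W w by (simp add: subspace_add subspace_scale)
    ultimately show "z \<in> (c X *s r X + a) +o W" by (auto simp: elt_set_plus_def)
  next
    fix z assume "z \<in> (c X *s r X + a) +o W"
    then obtain w where w: "w \<in> W" "z = c X *s (r X + 0) + (a + w)"
      by (auto simp: elt_set_plus_def algebra_simps)
    then show "z \<in> scale (c X) ` (r X +o W) + (a +o W)"
      using subspace_0[OF W] unfolding set_plus_def elt_set_plus_def by blast
  qed
  then show ?case using insert by (simp add: add.assoc)
qed

lemma coset_comb_eq:
  assumes "subspace W" "finite S" "\<And>X. X \<in> S \<Longrightarrow> X = r X +o W"
  shows "coset_comb scale W S c = (\<Sum>X\<in>S. c X *s r X) +o W"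
proof -
  have "coset_comb scale W S c = (\<Sum>X\<in>S. scale (c X) ` (r X +o W)) + W"
    unfolding coset_comb_def using assms(3) by (metis (no_types, lifting) sum.cong)
  then show ?thesis using sum_cosets[OF assms(1,2)] by simp
qed

end

context lie_algebra
begin

lemma br_add_left: "x \<in> L \<Longrightarrow> y \<in> L \<Longrightarrow> z \<in> L \<Longrightarrow> br (x + y) z = br x z + br y z"
  and br_add_right: "x \<in> L \<Longrightarrow> y \<in> L \<Longrightarrow> z \<in> L \<Longrightarrow> br x (y + z) = br x y + br x z"
  and br_scale_left: "x \<in> L \<Longrightarrow> y \<in> L \<Longrightarrow> br (c *s x) y = c *s br x y"
  and br_scale_right: "x \<in> L \<Longrightarrow> y \<in> L \<Longrightarrow> br x (c *s y) = c *s br x y"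
  using br_bilinear by (auto simp: bilinear_on_def linear_on_def)

lemma br_diff_right: "x \<in> L \<Longrightarrow> y \<in> L \<Longrightarrow> z \<in> L \<Longrightarrow> br x (y - z) = br x y - br x z"
  using br_add_right[of x "y - z" z] subspace_diff[OF subspace_L, of y z] by simp

lemma br_anti: "x \<in> L \<Longrightarrow> y \<in> L \<Longrightarrow> br x y = - br y x"
  using br_self[of "x + y"] br_self[of x] br_self[of y] subspace_add[OF subspace_L, of x y]
  by (simp add: br_add_left br_add_right eq_neg_iff_add_eq_0 add.commute)

lemma coboundaries2_subset_cocycles2: "coboundaries2 \<subseteq> cocycles2"
proof
  fix \<omega> assume "\<omega> \<in> coboundaries2"
  then obtain f where f: "f \<in> cochains1" and \<omega>: "\<omega> = d1 f"
    by (auto simp: coboundaries2_def)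
  note LI = subspace_add[OF subspace_L] subspace_diff[OF subspace_L] subspace_scale[OF subspace_L]
    br_closed
  have fL: "f x \<in> L" if "x \<in> L" for x using f that by (simp add: cochains1_def)
  have fadd: "f (x + y) = f x + f y" if "x \<in> L" "y \<in> L" for x y
    using f that by (simp add: cochains1_def linear_on_def)
  have fscale: "f (c *s x) = c *s f x" if "x \<in> L" for c x
    using f that by (simp add: cochains1_def linear_on_def)
  have fdiff: "f (x - y) = f x - f y" if "x \<in> L" "y \<in> L" for x y
    using fadd[of "x - y" y] that by (simp add: LI)
  have f0: "f 0 = 0"
    using fscale[OF subspace_0[OF subspace_L], of 0] by simp
  have fneg: "f (- x) = - f x" if "x \<in> L" for x
    using fdiff[of 0 x] that subspace_0[OF subspace_L] f0 by simp
  have d1L: "d1 f x y \<in> L" if "x \<in> L" "y \<in> L" for x y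
    using that by (simp add: d1_def LI fL)
  have "d1 f \<in> cochains2"
    unfolding cochains2_def bilinear_on_def linear_on_def
    by (auto simp: d1L br_self f0)
      (auto simp: d1_def LI fL fadd fscale br_add_left br_add_right br_scale_left br_scale_right
        br_self f0 algebra_simps scale_right_diff_distrib)
  moreover have "d2 (d1 f) x y z = 0" if L: "x \<in> L" "y \<in> L" "z \<in> L" for x y z
  proof -
    have J: "br u (br v w) = br (br u v) w + br v (br u w)"
      if "u \<in> L" "v \<in> L" "w \<in> L" for u v w
      using jacobi[OF that] br_anti[of w "br u v"] br_anti[of w u] that
        br_diff_right[of v 0 "br u w"] br_diff_right[of v 0 0] subspace_0[OF subspace_L]
      by (simp add: LI algebra_simps add_eq_0_iff)
    have neg: "br (br v u) w = - br w (br v u)" if "u \<in> L" "v \<in> L" "w \<in> L" for u v w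
      using that by (intro br_anti LI)
    have "f (br x (br y z)) = f (br (br x y) z) + f (br y (br x z))"
      using J[OF L] L by (simp add: fadd LI)
    moreover have "br (br x z) y = - br y (br x z)" "br (br y z) x = - br x (br y z)"
      using L by (simp_all add: neg)
    ultimately show ?thesis
      using L J[of x y "f z"] J[of x z "f y"] J[of y z "f x"] fneg
      by (simp add: d2_def d1_def LI fL br_diff_right br_add_right algebra_simps)
  qed
  then have "d2 (d1 f) = 0" by (auto simp: fun_eq_iff d2_def)
  ultimately show "\<omega> \<in> cocycles2" by (simp add: cocycles2_def \<omega>)
qed

lemma vector_space_cochain_scale: "vector_space cochain_scale"
  by unfold_locales (auto simp: cochain_scale_def fun_eq_iff scale_right_distrib scale_left_distrib)

end

text \<open>
  Every finite-dimensional complex vector space is isomorphic to a subspace of the space of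
  complex sequences.
\<close>

definition cscale :: "complex \<Rightarrow> (nat \<Rightarrow> complex) \<Rightarrow> nat \<Rightarrow> complex" where
  "cscale c v = (\<lambda>i. c * v i)"

lemma vector_space_cscale: "vector_space cscale"
  by unfold_locales (auto simp: cscale_def fun_eq_iff algebra_simps)

end

theory Submission
  imports Defs "HOL-Computational_Algebra.Polynomial"
begin

text \<open>
  Take the algebra with basis \<open>T, X, S, Z, Y\<^sub>0, \<dots>, Y\<^bsub>2r\<^esub>\<close> and nonzero brackets
  \<open>[T,X] = X\<close>, \<open>[T,Y\<^sub>i] = (r+i) Y\<^sub>i\<close>, \<open>[X,Y\<^sub>i] = Y\<^bsub>i+1\<^esub>\<close>, \<open>[Y\<^sub>0,Y\<^sub>j] = Y\<^bsub>r+j\<^esub>\<close>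
  for \<open>j \<ge> 1\<close>, and \<open>[S,Z] = Z\<close>. Its nilradical is a filiform algebra (spanned by \<open>X\<close> and
  the \<open>Y\<^sub>i\<close>) plus the line of \<open>Z\<close>, hence quasi-filiform. A derivation can be normalised by an
  inner one to kill \<open>T + S\<close>, so that it preserves the eigenspaces of \<open>ad (T + S)\<close>, and is
  then seen to be inner.

  For every \<open>p\<close> and \<open>q = 1 - p\<close>, the map
  \<open>(Y\<^sub>i, Y\<^sub>j) \<mapsto> (q\<^sup>i p\<^sup>j - p\<^sup>i q\<^sup>j) Y\<^bsub>r+i+j\<^esub>\<close> is a 2-cocycle: it is compatible with \<open>X\<close>
  because \<open>p + q = 1\<close>, with \<open>T\<close> by homogeneity, and all terms in three \<open>Y\<close>s have degree
  above the top. The \<open>Y\<^bsub>r+1+j\<^esub>\<close>-component of a coboundary at \<open>(Y\<^sub>1, Y\<^sub>j)\<close> vanishes for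
  \<open>j \<ge> 2\<close>, so by a Vandermonde argument the classes for distinct \<open>p = 2, \<dots>, m + 1\<close> are
  linearly independent.
\<close>

subsection \<open>Cosets, derivations and cohomology\<close>

lemma sum_apply2: "(\<Sum>a\<in>A. h a) x y = (\<Sum>a\<in>A. h a x y)"
  for h :: "'a \<Rightarrow> 'b \<Rightarrow> 'c \<Rightarrow> 'd::comm_monoid_add"
  by (induction A rule: infinite_finite_induct) auto

section \<open>Lower bounds for the dimension of a quotient\<close>

context vector_space
begin

text \<open>\<open>coset_dim\<close> is the size of an unspecified finite basis, or 0 if there is
  none. So a finite basis is exhibited first, by extending a basis of \<open>W\<close> to one of
  \<open>Z\<close>; an exchange argument then bounds the size of whichever basis was chosen.\<close>

lemma card_le_coset_dim:
  assumes W: "subspace W" and Z: "subspace Z" and WZ: "W \<subseteq> Z"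
    and fin: "finite F" "Z \<subseteq> span F"
    and J: "finite J" and wZ: "\<And>j. j \<in> J \<Longrightarrow> w j \<in> Z"
    and indep: "\<And>c. (\<Sum>j\<in>J. c j *s w j) \<in> W \<Longrightarrow> \<forall>j\<in>J. c j = 0"
  shows "card J \<le> coset_dim scale W (quotient_space Z W)"
proof -
  obtain B where B: "B \<subseteq> W" "independent B" "W \<subseteq> span B"
    using basis_exists by metis
  have spB: "span B = W" using B W by (metis span_subspace)
  obtain C where C: "B \<subseteq> C" "C \<subseteq> Z" "independent C" "Z \<subseteq> span C"
    using maximal_independent_subset_extend[of B Z] B WZ by (metis subset_trans)
  have finC: "finite C"
    using independent_span_bound[OF fin(1) C(3)] C(2) fin(2) by blast
  then have finB: "finite B" using C(1) finite_subset by blast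
  have coset_eq: "a +o W = b +o W \<longleftrightarrow> a - b \<in> W" for a b
  proof
    assume "a +o W = b +o W"
    moreover have "a \<in> a +o W" using subspace_0[OF W] by (force simp: elt_set_plus_def)
    ultimately show "a - b \<in> W" by (auto simp: elt_set_plus_def)
  next
    assume ab: "a - b \<in> W"
    have "\<exists>w'\<in>W. a + w = b + w'" if "w \<in> W" for w
      using subspace_add[OF W ab that] by (intro bexI[of _ "(a - b) + w"]) auto
    moreover have "\<exists>w'\<in>W. b + w = a + w'" if "w \<in> W" for w
      using subspace_diff[OF W that ab] by (intro bexI[of _ "w - (a - b)"]) auto
    ultimately show "a +o W = b +o W" by (auto simp: elt_set_plus_def)
  qed
  let ?D = "C - B"
  let ?S = "(\<lambda>v. v +o W) ` ?D"
  have "coset_basis scale W (quotient_space Z W) ?S"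
  proof -
    have inj: "inj_on (\<lambda>v. v +o W) ?D"
    proof (rule inj_onI, rule ccontr)
      fix a b assume ab: "a \<in> ?D" "b \<in> ?D" "a +o W = b +o W" "a \<noteq> b"
      then have "a - b \<in> span B" using coset_eq spB by simp
      moreover have "B \<subseteq> C - {a}" using C(1) ab(1) by blast
      ultimately have "a - b \<in> span (C - {a})" using span_mono by blast
      moreover have "b \<in> span (C - {a})" using ab by (auto intro: span_base)
      ultimately have "a \<in> span (C - {a})" using span_add by fastforce
      then show False using C(3) ab(1) dependent_def by blast
    qed
    define r where "r = inv_into ?D (\<lambda>v. v +o W)"
    have rX: "X = r X +o W" "r X \<in> ?D" if "X \<in> ?S" for X
      unfolding r_def using f_inv_into_f[OF that] inv_into_into[OF that] by simp_all
    have r: "r (v +o W) = v" if "v \<in> ?D" for v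
      unfolding r_def using inv_into_f_f[OF inj that] by simp
    have comb: "coset_comb scale W ?S c = (\<Sum>v\<in>?D. c (v +o W) *s v) +o W" for c
    proof -
      have "coset_comb scale W ?S c = (\<Sum>X\<in>?S. c X *s r X) +o W"
        using coset_comb_eq[OF W _ rX(1), of ?S c] finC by simp
      then show ?thesis by (simp add: sum.reindex[OF inj] r cong: sum.cong_simp)
    qed
    have W0: "W = 0 +o W" by (simp add: elt_set_plus_def)
    show ?thesis
      unfolding coset_basis_def
    proof (intro conjI allI impI ballI)
      show "finite ?S" using finC by simp
      show "?S \<subseteq> quotient_space Z W" using C(2) by (auto simp: quotient_space_def)
    next
      fix c X assume c: "coset_comb scale W ?S c = W" and "X \<in> ?S"
      then obtain v where v: "v \<in> ?D" "X = v +o W" by blast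
      let ?x = "\<Sum>v\<in>?D. c (v +o W) *s v"
      have "?x \<in> span B" using c comb W0 coset_eq[of ?x 0] spB by simp
      then obtain u where u: "?x = (\<Sum>b\<in>B. u b *s b)"
        using span_finite[OF finB] by auto
      \<comment> \<open>Moving the expansion in \<open>B\<close> to the other side turns a relation
        modulo \<open>W\<close> into a linear relation among the vectors of
        \<open>C\<close>.\<close>
      define h where "h b = (if b \<in> B then - u b else c (b +o W))" for b
      have "(\<Sum>b\<in>C. h b *s b) = (\<Sum>b\<in>?D. h b *s b) + (\<Sum>b\<in>B. h b *s b)"
        using finC C(1) by (simp add: sum.subset_diff)
      also have "\<dots> = 0"
        using u by (simp add: h_def sum_negf)
      finally have "h v = 0"
        using independentD[OF C(3) finC, of h v] v(1) by blast
      then show "c X = 0" using v by (simp add: h_def)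
    next
      fix X assume "X \<in> quotient_space Z W"
      then obtain z where z: "z \<in> Z" "X = z +o W" by (auto simp: quotient_space_def)
      then obtain u where u: "z = (\<Sum>b\<in>C. u b *s b)"
        using C(4) span_finite[OF finC] by auto
      have "z = (\<Sum>b\<in>?D. u b *s b) + (\<Sum>b\<in>B. u b *s b)"
        unfolding u using finC C(1) by (simp add: sum.subset_diff)
      moreover have "(\<Sum>b\<in>B. u b *s b) \<in> W"
        unfolding spB[symmetric] by (intro span_sum span_scale span_base)
      ultimately have "z +o W = (\<Sum>b\<in>?D. u b *s b) +o W" using coset_eq by simp
      then show "\<exists>c. X = coset_comb scale W ?S c"
        unfolding comb z(2) by (intro exI[of _ "\<lambda>X. u (r X)"]) (simp add: r cong: sum.cong_simp)
    qed
  qed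
  then have ex: "\<exists>S. coset_basis scale W (quotient_space Z W) S" by blast
  define S where "S = (SOME S. coset_basis scale W (quotient_space Z W) S)"
  have S: "coset_basis scale W (quotient_space Z W) S"
    unfolding S_def using ex by (rule someI_ex)
  have dim: "coset_dim scale W (quotient_space Z W) = card S"
    using ex by (simp add: coset_dim_def S_def)
  have finS: "finite S" using S by (simp add: coset_basis_def)
  define r where "r X = (SOME v. X = v +o W)" for X
  have rX: "X = r X +o W" if "X \<in> S" for X
  proof -
    have "\<exists>v. X = v +o W" using S that by (auto simp: coset_basis_def quotient_space_def)
    then show ?thesis unfolding r_def by (rule someI_ex)
  qed
  have w_span: "w j \<in> span (r ` S \<union> B)" if "j \<in> J" for j
  proof -
    have "w j +o W \<in> quotient_space Z W" using wZ that by (simp add: quotient_space_def)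
    then obtain c where "w j +o W = (\<Sum>X\<in>S. c X *s r X) +o W"
      using S coset_comb_eq[OF W finS rX] unfolding coset_basis_def by metis
    then have "w j - (\<Sum>X\<in>S. c X *s r X) \<in> span B" using coset_eq spB by simp
    then have 1: "w j - (\<Sum>X\<in>S. c X *s r X) \<in> span (r ` S \<union> B)"
      using span_mono[of B "r ` S \<union> B"] by blast
    have 2: "(\<Sum>X\<in>S. c X *s r X) \<in> span (r ` S \<union> B)"
      by (intro span_sum span_scale span_base) simp
    from span_add[OF 1 2] show ?thesis by simp
  qed
  \<comment> \<open>Together with injectivity of \<open>w\<close> this gives the union of
    \<open>B\<close> and the \<open>w j\<close> exactly \<open>card J + card B\<close>
    elements.\<close>
  have wW: "w j \<notin> W" if "j \<in> J" for j
  proof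
    assume "w j \<in> W"
    moreover have "(\<Sum>i\<in>J. (if i = j then 1 else 0) *s w i) = w j"
      using J that by (simp add: if_distrib[of "\<lambda>c. c *s _"] cong: if_cong)
    ultimately show False using indep[of "\<lambda>i. if i = j then 1 else 0"] that by auto
  qed
  have inj: "inj_on w J"
  proof (rule inj_onI, rule ccontr)
    fix i j assume ij: "i \<in> J" "j \<in> J" "w i = w j" "i \<noteq> j"
    let ?c = "\<lambda>k. if k = i then 1 else if k = j then - 1 else 0"
    have "(\<Sum>k\<in>J. ?c k *s w k) = (\<Sum>k\<in>{i,j}. ?c k *s w k)"
      using J ij by (intro sum.mono_neutral_right) auto
    also have "\<dots> = 0" using ij by simp
    finally show False using indep[of ?c] subspace_0[OF W] ij by auto
  qed
  have ind: "independent (w ` J \<union> B)"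
  proof (rule independent_if_scalars_zero)
    show "finite (w ` J \<union> B)" using J finB by simp
    fix h x assume h: "(\<Sum>x\<in>w ` J \<union> B. h x *s x) = 0" and x: "x \<in> w ` J \<union> B"
    have "(\<Sum>x\<in>w ` J \<union> B. h x *s x) = (\<Sum>x\<in>w ` J. h x *s x) + (\<Sum>x\<in>B. h x *s x)"
      using J finB wW B(1) by (intro sum.union_disjoint) auto
    then have eq: "(\<Sum>j\<in>J. h (w j) *s w j) + (\<Sum>x\<in>B. h x *s x) = 0"
      using h by (simp add: sum.reindex[OF inj])
    have "(\<Sum>x\<in>B. h x *s x) \<in> W"
      unfolding spB[symmetric] by (intro span_sum span_scale span_base)
    then have "(\<Sum>j\<in>J. h (w j) *s w j) \<in> W"
      using eq subspace_neg[OF W] by (metis eq_neg_iff_add_eq_0)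
    then have J0: "\<forall>j\<in>J. h (w j) = 0" by (rule indep)
    then have "(\<Sum>x\<in>B. h x *s x) = 0" using eq by simp
    then have "\<forall>x\<in>B. h x = 0" using independentD[OF B(2) finB] by blast
    then show "h x = 0" using x J0 by blast
  qed
  have "card J + card B = card (w ` J \<union> B)"
    using J finB wW B(1) by (subst card_Un_disjoint) (auto simp: card_image[OF inj])
  \<comment> \<open>Adjoining \<open>B\<close> to the representatives on both sides reduces counting
    modulo \<open>W\<close> to the usual exchange bound.\<close>
  also have "\<dots> \<le> card (r ` S \<union> B)"
    using w_span finS finB by (intro conjunct2[OF independent_span_bound] ind) (auto intro: span_base)
  also have "\<dots> \<le> card S + card B"
    using card_Un_le[of "r ` S" B] card_image_le[OF finS, of r] by linarith
  finally show ?thesis using dim by simp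
qed

end

section \<open>Derivations and the spaces of cochains of a general Lie algebra\<close>

context lie_algebra
begin

lemma ideal_lie_algebra:
  assumes "lie_ideal I"
  shows "lie_algebra scale I br"
proof
  have IL: "x \<in> L" if "x \<in> I" for x using assms that by (auto simp: lie_ideal_def)
  show "subspace I" using assms by (simp add: lie_ideal_def)
  show "br x y \<in> I" if "x \<in> I" "y \<in> I" for x y
    using assms that IL by (simp add: lie_ideal_def)
  show "bilinear_on scale I br"
    using br_bilinear IL by (simp add: bilinear_on_def linear_on_def)
  show "br x x = 0" if "x \<in> I" for x using br_self IL that by blast
  show "br x (br y z) + br y (br z x) + br z (br x y) = 0"
    if "x \<in> I" "y \<in> I" "z \<in> I" for x y z
    using jacobi IL that by blast
qed

lemma ad_derivation:
  assumes z: "z \<in> L"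
  shows "ad z \<in> derivations"
proof -
  have "br z (br x y) = br (br z x) y + br x (br z y)" if "x \<in> L" "y \<in> L" for x y
  proof -
    have "br y (br z x) = - br (br z x) y"
      using that z by (intro br_anti br_closed)
    moreover have "br x (br y z) = - br x (br z y)"
      using br_anti[OF that(2) z] br_scale_right[of x "br z y" "-1"] that z br_closed by simp
    ultimately show ?thesis
      using jacobi[OF z that] by (simp add: algebra_simps add_eq_0_iff2)
  qed
  then show ?thesis
    using z by (auto simp: derivations_def cochains1_def linear_on_def ad_def br_add_right
        br_scale_right br_closed subspace_add[OF subspace_L] subspace_scale[OF subspace_L])
qed

lemma br_diff_left: "x \<in> L \<Longrightarrow> y \<in> L \<Longrightarrow> z \<in> L \<Longrightarrow> br (x - y) z = br x z - br y z"
  using br_add_left[of "x - y" y z] subspace_diff[OF subspace_L, of x y] by simp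

lemma derivations_diff:
  assumes "D \<in> derivations" "E \<in> derivations"
  shows "(\<lambda>x. D x - E x) \<in> derivations"
  using assms
  by (auto simp: derivations_def cochains1_def linear_on_def br_diff_left br_diff_right
      scale_right_diff_distrib subspace_diff[OF subspace_L])

lemma linear_on_sum:
  assumes "linear_on scale L f" "finite A" "\<And>a. a \<in> A \<Longrightarrow> g a \<in> L"
  shows "f (\<Sum>a\<in>A. c a *s g a) = (\<Sum>a\<in>A. c a *s f (g a))"
  using assms(2,3)
proof (induction A rule: finite_induct)
  case empty
  have "f (0 *s 0) = 0 *s f 0"
    using assms(1) subspace_0[OF subspace_L] unfolding linear_on_def by blast
  then show ?case by simp
next
  case (insert a A)
  have "c a *s g a \<in> L" "(\<Sum>a\<in>A. c a *s g a) \<in> L"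
    using insert by (auto intro!: subspace_sum subspace_scale subspace_L)
  then show ?case using insert assms(1) by (simp add: linear_on_def)
qed

lemma subspace_cocycles2: "module.subspace cochain_scale cocycles2"
proof -
  interpret C: vector_space cochain_scale by (rule vector_space_cochain_scale)
  show ?thesis
  proof (rule C.subspaceI)
    show "0 \<in> cocycles2"
      using br_scale_right[of _ 0 0] subspace_0[OF subspace_L]
      by (auto simp: cocycles2_def cochains2_def bilinear_on_def linear_on_def d2_def fun_eq_iff)
  next
    fix \<omega> \<eta> assume *: "\<omega> \<in> cocycles2" "\<eta> \<in> cocycles2"
    have "\<omega> + \<eta> \<in> cochains2"
      using * by (auto simp: cocycles2_def cochains2_def bilinear_on_def linear_on_def
          scale_right_distrib subspace_add[OF subspace_L])
    moreover have "d2 (\<omega> + \<eta>) x y z = d2 \<omega> x y z + d2 \<eta> x y z" for x y z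
    proof -
      have "\<omega> u v \<in> L" "\<eta> u v \<in> L" if "u \<in> L" "v \<in> L" for u v
        using * that by (auto simp: cocycles2_def cochains2_def)
      then show ?thesis by (simp add: d2_def br_add_right)
    qed
    ultimately show "\<omega> + \<eta> \<in> cocycles2" using * by (simp add: cocycles2_def fun_eq_iff)
  next
    fix c \<omega> assume *: "\<omega> \<in> cocycles2"
    have "cochain_scale c \<omega> \<in> cochains2"
      using * by (auto simp: cocycles2_def cochains2_def bilinear_on_def linear_on_def
          scale_right_distrib subspace_scale[OF subspace_L] cochain_scale_def mult.commute)
    moreover have "d2 (cochain_scale c \<omega>) x y z = c *s d2 \<omega> x y z" for x y z
    proof -
      have "\<omega> u v \<in> L" if "u \<in> L" "v \<in> L" for u v
        using * that by (auto simp: cocycles2_def cochains2_def)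
      then show ?thesis
        by (simp add: d2_def br_scale_right cochain_scale_def scale_right_distrib
            scale_right_diff_distrib)
    qed
    ultimately show "cochain_scale c \<omega> \<in> cocycles2"
      using * by (simp add: cocycles2_def fun_eq_iff)
  qed
qed

lemma subspace_coboundaries2: "module.subspace cochain_scale coboundaries2"
proof -
  interpret C: vector_space cochain_scale by (rule vector_space_cochain_scale)
  show ?thesis
  proof (rule C.subspaceI)
    have "(\<lambda>_. 0) \<in> cochains1"
      using subspace_0[OF subspace_L] by (simp add: cochains1_def linear_on_def)
    moreover have "d1 (\<lambda>_. 0) = 0"
      using br_scale_right[of _ 0 0] subspace_0[OF subspace_L]
      by (auto simp: d1_def fun_eq_iff)
    ultimately show "0 \<in> coboundaries2" unfolding coboundaries2_def by (metis image_eqI)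
  next
    fix \<omega> \<eta> assume "\<omega> \<in> coboundaries2" "\<eta> \<in> coboundaries2"
    then obtain f g where *: "f \<in> cochains1" "g \<in> cochains1" "\<omega> = d1 f" "\<eta> = d1 g"
      by (auto simp: coboundaries2_def)
    have "f + g \<in> cochains1"
      using * by (auto simp: cochains1_def linear_on_def scale_right_distrib
          subspace_add[OF subspace_L])
    moreover have "d1 (f + g) = d1 f + d1 g"
      using * by (auto simp: d1_def fun_eq_iff cochains1_def br_add_right)
    ultimately show "\<omega> + \<eta> \<in> coboundaries2" using * unfolding coboundaries2_def by (metis image_eqI)
  next
    fix c \<omega> assume "\<omega> \<in> coboundaries2"
    then obtain f where *: "f \<in> cochains1" "\<omega> = d1 f" by (auto simp: coboundaries2_def)
    have "(\<lambda>x. c *s f x) \<in> cochains1"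
      using * by (auto simp: cochains1_def linear_on_def scale_right_distrib
          subspace_scale[OF subspace_L] mult.commute)
    moreover have "d1 (\<lambda>x. c *s f x) = cochain_scale c (d1 f)"
      using * by (auto simp: d1_def fun_eq_iff cochains1_def br_scale_right cochain_scale_def
          scale_right_diff_distrib)
    ultimately show "cochain_scale c \<omega> \<in> coboundaries2"
      using * unfolding coboundaries2_def by (metis image_eqI)
  qed
qed

text \<open>A bilinear map is determined by its values on pairs of basis vectors, so it is a
  combination of the elementary maps \<open>E (a, b, c)\<close>, which send the pair (a, b) to c and
  all other pairs of basis vectors to 0. These need not be alternating; only a finite spanning set
  in the ambient function space is wanted.\<close>

lemma cochains2_finite_span:
  assumes finite_dim
  shows "\<exists>F. finite F \<and> cochains2 \<subseteq> module.span cochain_scale F"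
proof -
  interpret C: vector_space cochain_scale by (rule vector_space_cochain_scale)
  obtain B0 where B0: "finite B0" "L = span B0" using assms finite_dim_def by blast
  obtain B where B: "B \<subseteq> B0" "independent B" "B0 \<subseteq> span B"
    using maximal_independent_subset by metis
  have LB: "L = span B" using B B0 by (metis span_eq span_superset subset_trans)
  have fB: "finite B" using B B0 finite_subset by blast
  have BL: "b \<in> L" if "b \<in> B" for b using LB that span_base by blast
  define E where "E = (\<lambda>(a, b, c) x y. if x \<in> L \<and> y \<in> L
    then (representation B x a * representation B y b) *s c else 0)"
  have rep: "(\<Sum>b\<in>B. representation B x b *s b) = x" if "x \<in> L" for x
    using sum_representation_eq[OF B(2) _ fB] that LB by simp
  have "\<omega> \<in> C.span (E ` (B \<times> B \<times> B))" if \<omega>: "\<omega> \<in> cochains2" for \<omega>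
  proof -
    have lin1: "linear_on scale L (\<omega> x)" and lin2: "linear_on scale L (\<lambda>y. \<omega> y x)"
      if "x \<in> L" for x
      using \<omega> that by (auto simp: cochains2_def bilinear_on_def)
    have \<omega>L: "\<omega> x y \<in> L" if "x \<in> L" "y \<in> L" for x y
      using \<omega> that by (auto simp: cochains2_def)
    define k where "k = (\<lambda>(a, b, c). representation B (\<omega> a b) c)"
    have "\<omega> x y = (\<Sum>(a,b,c)\<in>B \<times> B \<times> B. k (a,b,c) *s E (a,b,c) x y)" for x y
    proof (cases "x \<in> L \<and> y \<in> L")
      case True
      then have x: "x \<in> L" and y: "y \<in> L" by auto
      have "\<omega> x y = \<omega> (\<Sum>a\<in>B. representation B x a *s a) y" using rep[OF x] by simp
      also have "\<dots> = (\<Sum>a\<in>B. representation B x a *s \<omega> a y)"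
        using linear_on_sum[OF lin2[OF y] fB, of "\<lambda>a. a"] BL by simp
      also have "\<dots> = (\<Sum>a\<in>B. representation B x a *s \<omega> a (\<Sum>b\<in>B. representation B y b *s b))"
        using rep[OF y] by simp
      also have "\<dots> = (\<Sum>a\<in>B. representation B x a *s (\<Sum>b\<in>B. representation B y b *s \<omega> a b))"
        using linear_on_sum[OF lin1 fB, of _ "\<lambda>a. a"] BL by (intro sum.cong) auto
      also have "\<dots> = (\<Sum>a\<in>B. representation B x a *s (\<Sum>b\<in>B. representation B y b *s
          (\<Sum>c\<in>B. representation B (\<omega> a b) c *s c)))"
        using rep \<omega>L BL by (intro sum.cong) auto
      also have "\<dots> = (\<Sum>(a,b,c)\<in>B \<times> B \<times> B. k (a,b,c) *s E (a,b,c) x y)"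
        using x y by (simp add: E_def k_def scale_sum_right sum.cartesian_product split_beta
            mult_ac)
      finally show ?thesis .
    next
      case False
      then show ?thesis using \<omega> by (auto simp: cochains2_def E_def split_beta)
    qed
    then have "\<omega> = (\<Sum>t\<in>B \<times> B \<times> B. cochain_scale (k t) (E t))"
      by (intro ext) (auto simp: sum_apply2 cochain_scale_def split_beta)
    also have "\<dots> \<in> C.span (E ` (B \<times> B \<times> B))"
      by (intro C.span_sum C.span_scale C.span_base) auto
    finally show ?thesis .
  qed
  then show ?thesis using fB by (intro exI[of _ "E ` (B \<times> B \<times> B)"]) auto
qed

text \<open>Turns a lower bound for \<open>dim_H2\<close> into a pointwise condition: no nontrivial
  combination of the cocycles equals some \<open>d1 f\<close>.\<close>

lemma card_le_dim_H2:
  assumes finite_dim "finite J" "\<And>j. j \<in> J \<Longrightarrow> \<phi> j \<in> cocycles2"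
    and indep: "\<And>c f. f \<in> cochains1 \<Longrightarrow> (\<And>x y. (\<Sum>j\<in>J. c j *s \<phi> j x y) = d1 f x y) \<Longrightarrow>
      \<forall>j\<in>J. c j = 0"
  shows "card J \<le> dim_H2"
proof -
  interpret C: vector_space cochain_scale by (rule vector_space_cochain_scale)
  obtain F where F: "finite F" "cochains2 \<subseteq> C.span F"
    using cochains2_finite_span[OF assms(1)] by blast
  show ?thesis
    unfolding dim_H2_def H2_def
  proof (rule C.card_le_coset_dim[OF subspace_coboundaries2 subspace_cocycles2
        coboundaries2_subset_cocycles2 F(1) _ assms(2,3)])
    show "cocycles2 \<subseteq> C.span F" using F(2) by (auto simp: cocycles2_def)
    fix c assume "(\<Sum>j\<in>J. cochain_scale (c j) (\<phi> j)) \<in> coboundaries2"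
    then obtain f where f: "f \<in> cochains1" "(\<Sum>j\<in>J. cochain_scale (c j) (\<phi> j)) = d1 f"
      by (auto simp: coboundaries2_def)
    have "(\<Sum>j\<in>J. c j *s \<phi> j x y) = d1 f x y" for x y
      unfolding f(2)[symmetric] by (simp add: sum_apply2 cochain_scale_def)
    with f(1) show "\<forall>j\<in>J. c j = 0" by (rule indep)
  qed
qed

end

subsection \<open>The Lie algebra and its derivations\<close>

interpretation cseq: vector_space cscale by (rule vector_space_cscale)

definition unit_vec :: "nat \<Rightarrow> nat \<Rightarrow> complex" where
  "unit_vec k = (\<lambda>i. if i = k then 1 else 0)"

definition supported :: "nat set \<Rightarrow> (nat \<Rightarrow> complex) set" where
  "supported A = {v. \<forall>i. i \<notin> A \<longrightarrow> v i = 0}"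

lemma subspace_supported: "cseq.subspace (supported A)"
  by (rule cseq.subspaceI) (auto simp: supported_def cscale_def)

lemma supported_mono: "A \<subseteq> B \<Longrightarrow> supported A \<subseteq> supported B"
  by (auto simp: supported_def)

lemma supported_0_iff: "supported A = {0} \<longleftrightarrow> A = {}"
proof
  assume *: "supported A = {0}"
  show "A = {}"
  proof (rule ccontr)
    assume "A \<noteq> {}"
    then obtain a where "a \<in> A" by blast
    then have "unit_vec a \<in> supported A" by (auto simp: supported_def unit_vec_def)
    with * have "unit_vec a a = 0" by simp
    then show False by (simp add: unit_vec_def)
  qed
qed (auto simp: supported_def)

lemma unit_vec_in_supported [simp]: "unit_vec k \<in> supported A \<longleftrightarrow> k \<in> A"
  by (auto simp: unit_vec_def supported_def)

lemma inj_unit_vec: "inj unit_vec"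
  by (rule injI) (metis unit_vec_def zero_neq_one)

lemma sum_cscale_apply: "(\<Sum>a\<in>A. cscale (c a) (g a)) k = (\<Sum>a\<in>A. c a * g a k)"
  by (induction A rule: infinite_finite_induct) (auto simp: cscale_def)

lemma supported_expand:
  assumes "finite A" "v \<in> supported A"
  shows "(\<Sum>a\<in>A. cscale (v a) (unit_vec a)) = v"
  using assms by (auto simp: sum_cscale_apply unit_vec_def supported_def if_distrib
      fun_eq_iff cong: if_cong)

lemma span_unit_vec:
  assumes "finite A"
  shows "cseq.span (unit_vec ` A) = supported A"
proof (rule cseq.span_subspace)
  show "supported A \<subseteq> cseq.span (unit_vec ` A)"
  proof
    fix v assume "v \<in> supported A"
    from supported_expand[OF assms this] show "v \<in> cseq.span (unit_vec ` A)"
      by (metis (no_types, lifting) cseq.span_base cseq.span_scale cseq.span_sum imageI)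
  qed
qed (auto simp: subspace_supported)

lemma independent_unit_vec: "finite A \<Longrightarrow> cseq.independent (unit_vec ` A)"
proof (rule cseq.independent_if_scalars_zero)
  fix f x
  assume A: "finite A" and sum: "(\<Sum>x\<in>unit_vec ` A. cscale (f x) x) = 0" and "x \<in> unit_vec ` A"
  then obtain a where a: "a \<in> A" "x = unit_vec a" by blast
  have "(\<Sum>x\<in>unit_vec ` A. cscale (f x) x) = (\<Sum>b\<in>A. cscale (f (unit_vec b)) (unit_vec b))"
    using inj_unit_vec by (subst sum.reindex) (auto intro: inj_on_subset)
  then have "(\<Sum>b\<in>A. cscale (f (unit_vec b)) (unit_vec b)) a = 0" using sum by simp
  then show "f x = 0"
    using A a by (simp add: sum_cscale_apply unit_vec_def if_distrib cong: if_cong)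
qed simp

lemma dim_supported: "finite A \<Longrightarrow> cseq.dim (supported A) = card A"
  using cseq.dim_eq_card[OF _ independent_unit_vec, of A "supported A"] span_unit_vec[of A]
    inj_unit_vec
  by (metis card_image cseq.span_eq_iff inj_on_subset subset_UNIV subspace_supported)

text \<open>
  The coordinates \<open>0, 1, 2, 3\<close> belong to \<open>T, X, S, Z\<close>, and \<open>4 + i\<close> belongs to \<open>Y\<^sub>i\<close>. A
  coordinate of the bracket depends only on coordinates that are not larger; cutting off at
  \<open>2 * r + 5\<close> is therefore compatible with the Jacobi identity.
\<close>

definition model_br :: "nat \<Rightarrow> (nat \<Rightarrow> complex) \<Rightarrow> (nat \<Rightarrow> complex) \<Rightarrow> nat \<Rightarrow> complex" where
  "model_br r x y = (\<lambda>k.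
     if k = 1 then x 0 * y 1 - y 0 * x 1
     else if k = 3 then x 2 * y 3 - y 2 * x 3
     else if 4 \<le> k \<and> k < 2*r+5 then
       of_nat (r + (k - 4)) * (x 0 * y k - y 0 * x k)
       + (if 4 < k then x 1 * y (k - 1) - y 1 * x (k - 1) else 0)
       + (if r + 4 < k then x 4 * y (k - r) - y 4 * x (k - r) else 0)
     else 0)"

section \<open>The model is a Lie algebra\<close>

abbreviation model_space :: "nat \<Rightarrow> (nat \<Rightarrow> complex) set" where
  "model_space r \<equiv> supported {..<2*r+5}"

text \<open>Checked coordinate by coordinate. The X-term of the bracket starts above coordinate 4
  and the Y_0-term above \<open>r + 4\<close>, so the expanded double bracket changes shape only at
  the thresholds separating the cases.\<close>

lemma model_jacobi:
  assumes "r > 0"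
  shows "model_br r x (model_br r y z) k + model_br r y (model_br r z x) k
    + model_br r z (model_br r x y) k = 0"
proof -
  consider "k < 4" | "2*r+5 \<le> k" | "k = 4" | "k = 5" "r \<ge> 1"
    | j where "k = 6 + j" "k \<le> r + 4" | "k = r + 5" "r \<ge> 1"
    | j where "k = r + 6 + j" "j < r - 1"
  proof -
    assume *: "k < 4 \<Longrightarrow> thesis" "2*r+5 \<le> k \<Longrightarrow> thesis" "k = 4 \<Longrightarrow> thesis"
      "k = 5 \<Longrightarrow> r \<ge> 1 \<Longrightarrow> thesis" "\<And>j. k = 6 + j \<Longrightarrow> k \<le> r + 4 \<Longrightarrow> thesis"
      "k = r + 5 \<Longrightarrow> r \<ge> 1 \<Longrightarrow> thesis" "\<And>j. k = r + 6 + j \<Longrightarrow> j < r - 1 \<Longrightarrow> thesis"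
    show thesis
      using *(5)[of "k - 6"] *(7)[of "k - (r + 6)"] *(1-4,6) assms by linarith
  qed
  then show ?thesis
  proof cases
    case 1
    then consider "k = 0" | "k = 1" | "k = 2" | "k = 3" by linarith
    then show ?thesis by cases (auto simp: model_br_def algebra_simps)
  next
    case 4
    then show ?thesis by (auto simp: model_br_def algebra_simps)
  next
    case (5 j)
    have "6 + j - 1 = 5 + j" "5 + j - 1 = 4 + j" "5 + j - 4 = Suc j" "6 + j - 4 = Suc (Suc j)"
      by simp_all
    with 5 show ?thesis by (simp add: model_br_def algebra_simps)
  next
    case 6
    have "r + 5 - 1 = r + 4" "r + 5 - r = 5" "r + 5 - 4 = Suc r" by simp_all
    with 6 show ?thesis by (cases "r = 0") (simp_all add: model_br_def algebra_simps)
  next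
    case (7 j)
    have idx: "r + 6 + j - 1 = r + 5 + j" "r + 6 + j - r = 6 + j" "r + 5 + j - r = 5 + j"
      "r + 5 + j - 1 = r + 4 + j" "6 + j - 1 = 5 + j" "6 + j - 4 = Suc (Suc j)"
      "r + 6 + j - 4 = Suc (Suc (r + j))" "r + 5 + j - 4 = Suc (r + j)" "Suc j < r"
      using 7 by simp_all
    \<comment> \<open>Since \<open>6 + j \<le> r + 4\<close>, the third formula has no Y_0-term:
      bracketing twice with Y_0 raises the index by \<open>2*r\<close> and leaves the range.\<close>
    have E: "model_br r u v (r + 6 + j) =
        (2 * of_nat r + of_nat j + 2) * (u 0 * v (r + 6 + j) - v 0 * u (r + 6 + j))
        + (u 1 * v (r + 5 + j) - v 1 * u (r + 5 + j)) + (u 4 * v (6 + j) - v 4 * u (6 + j))"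
      "model_br r u v (r + 5 + j) =
        (2 * of_nat r + of_nat j + 1) * (u 0 * v (r + 5 + j) - v 0 * u (r + 5 + j))
        + (u 1 * v (r + 4 + j) - v 1 * u (r + 4 + j))
        + (u 4 * v (5 + j) - v 4 * u (5 + j))"
      "model_br r u v (6 + j) = (of_nat r + of_nat j + 2) * (u 0 * v (6 + j) - v 0 * u (6 + j))
        + (u 1 * v (5 + j) - v 1 * u (5 + j))"
      "model_br r u v 0 = 0" "model_br r u v 1 = u 0 * v 1 - v 0 * u 1"
      "model_br r u v 4 = of_nat r * (u 0 * v 4 - v 0 * u 4)" for u v
      using idx by (simp_all add: model_br_def algebra_simps)
    have outer: "model_br r u v k =
        (2 * of_nat r + of_nat j + 2) * (u 0 * v (r + 6 + j) - v 0 * u (r + 6 + j))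
        + (u 1 * v (r + 5 + j) - v 1 * u (r + 5 + j)) + (u 4 * v (6 + j) - v 4 * u (6 + j))" for u v
      unfolding 7(1) by (rule E(1))
    show ?thesis unfolding outer E by (simp add: algebra_simps)
  qed (auto simp: model_br_def algebra_simps)
qed

lemma model_lie_algebra:
  assumes "r > 0"
  shows "lie_algebra cscale (model_space r) (model_br r)"
proof
  show "cseq.subspace (model_space r)" by (rule subspace_supported)
  show "model_br r x y \<in> model_space r" for x y
    by (auto simp: supported_def model_br_def)
  show "bilinear_on cscale (model_space r) (model_br r)"
    by (auto simp: bilinear_on_def linear_on_def model_br_def cscale_def fun_eq_iff algebra_simps)
  show "model_br r x x = 0" for x
    by (auto simp: model_br_def fun_eq_iff)
  show "model_br r x (model_br r y z) + model_br r y (model_br r z x)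
    + model_br r z (model_br r x y) = 0" for x y z
    using model_jacobi[OF assms] by (auto simp: fun_eq_iff)
qed


text \<open>With \<open>r \<ge> 2\<close> all Y_i have weight at least 2 under T + S, so they share
  no eigenspace with T and S (weight 0) or with X and Z (weight 1).\<close>

locale model =
  fixes r :: nat
  assumes r_ge_2: "r \<ge> 2"
begin

sublocale lie_algebra cscale "model_space r" "model_br r"
  using r_ge_2 by (intro model_lie_algebra) simp

lemma finite_dim_model: finite_dim
  unfolding finite_dim_def by (rule exI[of _ "unit_vec ` {..<2*r+5}"]) (simp add: span_unit_vec)

text \<open>Each coordinate of a central element is read off from its bracket with one basis vector:
  T and X detect each other, so do S and Z, and T detects Y_i through the nonzero factor r +
  i.\<close>

lemma center_model: "center = {0}"
proof
  show "center \<subseteq> {0}"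
  proof
    fix x assume "x \<in> center"
    then have xL: "x \<in> model_space r" and c: "\<And>y. y \<in> model_space r \<Longrightarrow> model_br r x y = 0"
      by (auto simp: center_def)
    have br0: "model_br r x (unit_vec i) k = 0" if "i < 2*r+5" for i k
      using c that by simp
    have "x k = 0" for k
    proof -
      consider "k = 0" | "k = 1" | "k = 2" | "k = 3" | "4 \<le> k" "k < 2*r+5" | "2*r+5 \<le> k"
        by linarith
      then show ?thesis
      proof cases
        case 1 then show ?thesis using br0[of 1 1] by (simp add: model_br_def unit_vec_def)
      next
        case 2 then show ?thesis using br0[of 0 1] by (simp add: model_br_def unit_vec_def)
      next
        case 3 then show ?thesis using br0[of 3 3] by (simp add: model_br_def unit_vec_def)
      next
        case 4 then show ?thesis using br0[of 2 3] by (simp add: model_br_def unit_vec_def)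
      next
        case 5
        then have "model_br r x (unit_vec 0) k = - (of_nat (r + (k - 4)) * x k)"
          by (auto simp: model_br_def unit_vec_def)
        then have "of_nat (r + (k - 4)) * x k = 0"
          using br0[of 0 k] by simp
        then show ?thesis using r_ge_2 by (simp del: of_nat_add)
      next
        case 6 then show ?thesis using xL by (simp add: supported_def)
      qed
    qed
    then show "x \<in> {0}" by (simp add: fun_eq_iff)
  qed
  show "{0} \<subseteq> center"
    using cseq.subspace_0[OF subspace_supported]
    by (auto simp: center_def) (auto simp: model_br_def fun_eq_iff)
qed

text \<open>The eigenvalue of ad (T + S) on the basis vector with index \<open>k\<close>. The value
  0 beyond the cutoff lets \<open>br_grading\<close> hold for arbitrary sequences.\<close>

definition weight :: "nat \<Rightarrow> nat" where
  "weight k = (if k = 1 \<or> k = 3 then 1 else if 4 \<le> k \<and> k < 2*r+5 then r + (k - 4) else 0)"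

lemma br_grading: "model_br r (unit_vec 0 + unit_vec 2) v k = of_nat (weight k) * v k"
  by (auto simp: model_br_def unit_vec_def weight_def)

section \<open>Structure constants and derivations\<close>

lemma br_T: "model_br r (unit_vec 0) (unit_vec 1) = unit_vec 1"
  and br_S: "model_br r (unit_vec 2) (unit_vec 3) = unit_vec 3"
  and br_T_Z: "model_br r (unit_vec 0) (unit_vec 3) = 0"
  by (simp_all add: model_br_def fun_eq_iff) (auto simp: unit_vec_def)

lemma br_X: "model_br r (unit_vec 1) v =
    (\<lambda>k. if k = 1 then - v 0 else if 4 < k \<and> k < 2*r+5 then v (k - 1) else 0)"
proof
  fix k
  show "model_br r (unit_vec 1) v k =
    (if k = 1 then - v 0 else if 4 < k \<and> k < 2*r+5 then v (k - 1) else 0)"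
  proof (cases "4 \<le> k \<and> k < 2*r+5")
    case True
    then have "unit_vec 1 k = 0" "4 < k \<Longrightarrow> unit_vec 1 (k - 1) = 0"
      "r + 4 < k \<Longrightarrow> unit_vec 1 (k - r) = 0"
      "unit_vec 1 0 = 0" "unit_vec 1 1 = 1" "unit_vec 1 4 = 0"
      by (simp_all add: unit_vec_def)
    with True show ?thesis by (simp add: model_br_def)
  qed (auto simp: model_br_def unit_vec_def)
qed

lemma br_X_Y:
  assumes "4 \<le> k" "Suc k < 2*r+5"
  shows "model_br r (unit_vec 1) (unit_vec k) = unit_vec (Suc k)"
  unfolding br_X using assms by (auto simp: unit_vec_def fun_eq_iff)

lemma br_Y0_Y1: "model_br r (unit_vec 4) (unit_vec 5) = unit_vec (r + 5)"
  using r_ge_2 by (auto simp: model_br_def unit_vec_def fun_eq_iff)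

lemma br_weight:
  "k < 2*r+5 \<Longrightarrow>
    model_br r (unit_vec 0 + unit_vec 2) (unit_vec k) = cscale (of_nat (weight k)) (unit_vec k)"
  by (rule ext) (simp only: br_grading cscale_def, simp add: unit_vec_def)

text \<open>As \<open>D\<close> kills T + S, it commutes with ad (T + S) and preserves weights. The
  relations [T,X] = X, [S,Z] = Z and [T,Z] = 0 then force \<open>D\<close> to vanish on T, X, S, Z.
  Each Y_i spans its weight space, [X,Y_i] = Y_(i+1) makes \<open>D\<close> one scalar
  \<open>b\<close> on all of them, and [Y_0,Y_1] = Y_(r+1) gives b = 2b.\<close>

lemma normalized_derivation_zero:
  assumes D: "D \<in> derivations"
    and H: "D (unit_vec 0 + unit_vec 2) = 0"
    and X: "D (unit_vec 1) 1 = 0" and Z: "D (unit_vec 3) 3 = 0"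
    and v: "v \<in> model_space r"
  shows "D v = 0"
proof -
  have lin: "linear_on cscale (model_space r) D"
    and DL: "\<And>x. x \<in> model_space r \<Longrightarrow> D x \<in> model_space r"
    and der: "\<And>x y. x \<in> model_space r \<Longrightarrow> y \<in> model_space r \<Longrightarrow>
      D (model_br r x y) = model_br r (D x) y + model_br r x (D y)"
    using D by (auto simp: derivations_def cochains1_def)
  have D0: "D 0 = 0"
    using linear_on_sum[OF lin, of "{}" "\<lambda>_. 0"] by simp
  have Dcs: "D (cscale c x) = cscale c (D x)" if "x \<in> model_space r" for c x
    using lin that by (simp add: linear_on_def)
  have Dout: "D x k = 0" if "x \<in> model_space r" "2*r+5 \<le> k" for x k
    using DL[OF that(1)] that(2) by (auto simp: supported_def)
  have HL: "unit_vec 0 + unit_vec 2 \<in> model_space r"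
    by (auto simp: supported_def unit_vec_def)
  have weight: "of_nat (weight j) * D (unit_vec k) j = of_nat (weight k) * D (unit_vec k) j"
    if "k < 2*r+5" for j k
  proof -
    have "cscale (of_nat (weight k)) (D (unit_vec k)) =
      model_br r 0 (unit_vec k) + model_br r (unit_vec 0 + unit_vec 2) (D (unit_vec k))"
      using der[OF HL, of "unit_vec k"] that by (simp add: br_weight Dcs H)
    then have "cscale (of_nat (weight k)) (D (unit_vec k)) j =
      model_br r 0 (unit_vec k) j + model_br r (unit_vec 0 + unit_vec 2) (D (unit_vec k)) j"
      by simp
    then show ?thesis by (simp add: cscale_def br_grading) (simp add: model_br_def)
  qed
  have wt: "D (unit_vec k) j = 0" if "k < 2*r+5" "weight j \<noteq> weight k" for j k
    using weight[of k j] that by auto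
  have wt1: "weight j \<noteq> 1" if "j \<noteq> 1" "j \<noteq> 3" for j
    using that r_ge_2 by (auto simp: weight_def)
  have TX: "D (unit_vec 1) = model_br r (D (unit_vec 0)) (unit_vec 1)
      + model_br r (unit_vec 0) (D (unit_vec 1))"
    using der[of "unit_vec 0" "unit_vec 1"] by (simp add: br_T[simplified])
  have SZ: "D (unit_vec 3) = model_br r (D (unit_vec 2)) (unit_vec 3)
      + model_br r (unit_vec 2) (D (unit_vec 3))"
    using der[of "unit_vec 2" "unit_vec 3"] by (simp add: br_S)
  have TZ: "0 = model_br r (D (unit_vec 0)) (unit_vec 3)
      + model_br r (unit_vec 0) (D (unit_vec 3))"
    using der[of "unit_vec 0" "unit_vec 3"] by (simp add: br_T_Z D0)
  have DX: "D (unit_vec 1) = 0"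
  proof
    fix k
    \<comment> \<open>In \<open>D\<close> applied to [T,X] = X, both brackets on the right have zero
      Z-component, so X does not mix with Z.\<close>
    have "D (unit_vec 1) 3 = 0"
      using fun_cong[OF TX, of 3] by (simp add: model_br_def unit_vec_def)
    then show "D (unit_vec 1) k = 0 k"
      using X wt[of 1 k] wt1[of k] by (cases "k = 1 \<or> k = 3") (auto simp: weight_def)
  qed
  have DZ: "D (unit_vec 3) = 0"
  proof
    fix k
    have "D (unit_vec 3) 1 = 0"
      using fun_cong[OF SZ, of 1] by (simp add: model_br_def unit_vec_def)
    then show "D (unit_vec 3) k = 0 k"
      using Z wt[of 3 k] wt1[of k] by (cases "k = 1 \<or> k = 3") (auto simp: weight_def)
  qed
  have DT: "D (unit_vec 0) = 0"
  proof
    fix k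
    \<comment> \<open>With X and Z killed, [T,X] = X and [T,Z] = 0 say that the image of T commutes
      with X and with Z; this removes its T- and S-components.\<close>
    have "D (unit_vec 0) 0 = 0"
      using fun_cong[OF TX, of 1] DX by (simp add: model_br_def unit_vec_def)
    moreover have "D (unit_vec 0) 2 = 0"
      using fun_cong[OF TZ, of 3] DZ by (simp add: model_br_def unit_vec_def)
    moreover have "weight k \<noteq> 0" if "k \<noteq> 0" "k \<noteq> 2" "k < 2*r+5"
      using that r_ge_2 by (auto simp: weight_def)
    ultimately show "D (unit_vec 0) k = 0 k"
      using wt[of 0 k] Dout[of "unit_vec 0" k]
      by (cases "k = 0 \<or> k = 2"; cases "k < 2*r+5") (auto simp: weight_def)
  qed
  have DS: "D (unit_vec 2) = 0"
    using H lin DT by (simp add: linear_on_def)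
  define b where "b = D (unit_vec 4) 4"
  have DY0: "D (unit_vec 4) = cscale b (unit_vec 4)"
  proof
    fix k
    have "weight k \<noteq> weight 4" if "k \<noteq> 4"
      using that r_ge_2 by (auto simp: weight_def)
    then show "D (unit_vec 4) k = cscale b (unit_vec 4) k"
      using wt[of 4 k] by (cases "k = 4") (auto simp: b_def cscale_def unit_vec_def)
  qed
  have DY: "D (unit_vec (4 + i)) = cscale b (unit_vec (4 + i))" if "4 + i < 2*r+5" for i
    using that
  proof (induction i)
    case 0 then show ?case using DY0 by simp
  next
    case (Suc i)
    have "D (model_br r (unit_vec 1) (unit_vec (4 + i))) =
        model_br r 0 (unit_vec (4 + i)) + model_br r (unit_vec 1) (cscale b (unit_vec (4 + i)))"
      using der[of "unit_vec 1" "unit_vec (4 + i)"] Suc DX by simp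
    also have "\<dots> = model_br r (unit_vec 1) (cscale b (unit_vec (4 + i)))"
      by (auto simp: fun_eq_iff model_br_def)
    also have "\<dots> = cscale b (model_br r (unit_vec 1) (unit_vec (4 + i)))"
      using Suc by (intro br_scale_right) auto
    finally show ?case using br_X_Y[of "4 + i"] Suc by simp
  qed
  have "b = 0"
  proof -
    have 5: "D (unit_vec 5) = cscale b (unit_vec 5)" using DY[of 1] r_ge_2 by simp
    have "D (unit_vec (r + 5)) = cscale b (unit_vec (r + 5))"
      using DY[of "r + 1"] r_ge_2 by (simp add: add.commute)
    moreover have "D (unit_vec (r + 5)) = model_br r (cscale b (unit_vec 4)) (unit_vec 5)
        + model_br r (unit_vec 4) (cscale b (unit_vec 5))"
      using der[of "unit_vec 4" "unit_vec 5"] DY0 5 r_ge_2 by (simp add: br_Y0_Y1)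
    moreover have "\<dots> = cscale b (unit_vec (r + 5)) + cscale b (unit_vec (r + 5))"
      using r_ge_2 by (simp add: br_scale_left br_scale_right br_Y0_Y1)
    ultimately have "cscale b (unit_vec (r + 5)) = 0"
      by (metis add_cancel_left_left)
    from fun_cong[OF this, of "r + 5"] show ?thesis by (simp add: cscale_def unit_vec_def)
  qed
  have Dk: "D (unit_vec k) = 0" if "k < 2*r+5" for k
  proof -
    consider "k = 0" | "k = 1" | "k = 2" | "k = 3" | "4 \<le> k" by linarith
    then show ?thesis
      using DT DX DS DZ DY[of "k - 4"] \<open>b = 0\<close> that by cases (auto simp: cscale_def fun_eq_iff)
  qed
  have "D (\<Sum>k<2*r+5. cscale (v k) (unit_vec k)) = (\<Sum>k<2*r+5. cscale (v k) (D (unit_vec k)))"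
    by (rule linear_on_sum[OF lin]) auto
  then show "D v = 0" using supported_expand[OF _ v] by (simp add: Dk)
qed

lemma derivations_model: "derivations = ad ` model_space r"
proof
  show "ad ` model_space r \<subseteq> derivations" using ad_derivation by blast
  show "derivations \<subseteq> ad ` model_space r"
  proof
    fix D assume D: "D \<in> derivations"
    have DL: "\<And>x. x \<in> model_space r \<Longrightarrow> D x \<in> model_space r"
      and Dout: "\<And>x. x \<notin> model_space r \<Longrightarrow> D x = 0"
      and der: "\<And>x y. x \<in> model_space r \<Longrightarrow> y \<in> model_space r \<Longrightarrow>
        D (model_br r x y) = model_br r (D x) y + model_br r x (D y)"
      using D by (auto simp: derivations_def cochains1_def)
    define H where "H = unit_vec 0 + unit_vec 2"
    have HL: "H \<in> model_space r" by (auto simp: H_def supported_def unit_vec_def)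
    \<comment> \<open>Off weight 0 the entries are forced by [z, H] = D H. The T- and S-entries do
      not affect [z, H]; they are spent on cancelling the diagonal entries of \<open>D\<close> at X
      and Z. Beyond the cutoff division by zero gives 0.\<close>
    define z where "z = (\<lambda>k. if k = 0 then D (unit_vec 1) 1 else if k = 2 then D (unit_vec 3) 3
      else - D H k / of_nat (weight k))"
    have zL: "z \<in> model_space r" by (auto simp: z_def supported_def weight_def)
    define D' where "D' x = D x - ad z x" for x
    have D': "D' \<in> derivations"
      unfolding D'_def using derivations_diff[OF D ad_derivation[OF zL]] .
    \<comment> \<open>Apply \<open>D\<close> to [H,X] = X and compare X-components; the same with Z
      below. Thus \<open>D H\<close> has no weight-0 part, which no bracket with \<open>H\<close>
      could produce.\<close>
    have "D H 0 = 0"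
      using fun_cong[OF der[OF HL, of "unit_vec 1"], of 1]
      by (simp add: H_def br_grading br_weight cscale_def weight_def)
        (simp add: model_br_def unit_vec_def)
    moreover have "D H 2 = 0"
      using fun_cong[OF der[OF HL, of "unit_vec 3"], of 3]
      by (simp add: H_def br_grading br_weight cscale_def weight_def)
        (simp add: model_br_def unit_vec_def)
    moreover have "D H k = 0" if "2*r+5 \<le> k" for k
      using DL[OF HL] that by (auto simp: supported_def)
    moreover have "weight k \<noteq> 0" if "k \<noteq> 0" "k \<noteq> 2" "k < 2*r+5" for k
      using that r_ge_2 by (auto simp: weight_def)
    ultimately have zH: "of_nat (weight k) * z k = - D H k" for k
      by (cases "k = 0 \<or> k = 2 \<or> 2*r+5 \<le> k") (auto simp: z_def weight_def)
    have "D' H = 0"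
    proof
      fix k
      have "D' H k = D H k + model_br r H z k"
        using br_anti[OF zL HL] HL by (simp add: D'_def ad_def)
      then show "D' H k = 0 k" using zH by (simp add: H_def br_grading)
    qed
    moreover have "D' (unit_vec 1) 1 = 0" "D' (unit_vec 3) 3 = 0"
      by (simp_all add: D'_def ad_def) (simp_all add: model_br_def z_def unit_vec_def)
    ultimately have "D' v = 0" if "v \<in> model_space r" for v
      using normalized_derivation_zero[OF D' _ _ _ that] unfolding H_def by blast
    then have "D v = ad z v" for v
      using Dout by (cases "v \<in> model_space r") (simp_all add: D'_def ad_def)
    then have "D = ad z" ..
    then show "D \<in> ad ` model_space r" using zL by blast
  qed
qed

lemma complete_model: complete_lie
  by (simp add: complete_lie_def center_model derivations_model)

subsection \<open>The nilradical\<close>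

abbreviation nil_space :: "(nat \<Rightarrow> complex) set" where
  "nil_space \<equiv> supported ({..<2*r+5} - {0, 2})"

lemma nil_ideal: "lie_ideal nil_space"
  unfolding lie_ideal_def
proof (intro conjI ballI)
  show "cseq.subspace nil_space" by (rule subspace_supported)
  show "nil_space \<subseteq> model_space r" by (rule supported_mono) blast
  show "model_br r x y \<in> nil_space" for x y
    by (auto simp: supported_def model_br_def)
qed

sublocale nil: lie_algebra cscale nil_space "model_br r"
  by (rule ideal_lie_algebra[OF nil_ideal])

text \<open>One step of the lower central series. The assumption \<open>supp\<close> bounds the
  bracket space from above; from below, bracketing with X already shifts every Y_j to the next one,
  up to sign.\<close>

lemma nil_bracket_space:
  assumes "4 \<le> a" "supported {a..<2*r+5} \<subseteq> U" "U \<subseteq> nil_space"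
    and supp: "\<And>u v k. u \<in> U \<Longrightarrow> v \<in> nil_space \<Longrightarrow> k \<le> a \<Longrightarrow> model_br r u v k = 0"
  shows "nil.bracket_space U nil_space = supported {Suc a..<2*r+5}"
  unfolding nil.bracket_space_def
proof (rule cseq.span_subspace)
  show "{model_br r x y |x y. x \<in> U \<and> y \<in> nil_space} \<subseteq> supported {Suc a..<2*r+5}"
  proof clarify
    fix x y assume "x \<in> U" "y \<in> nil_space"
    then have "model_br r x y k = 0" if "k \<le> a" for k using supp that by blast
    moreover have "model_br r x y k = 0" if "2*r+5 \<le> k" for k
      using that by (simp add: model_br_def)
    ultimately show "model_br r x y \<in> supported {Suc a..<2*r+5}"
      by (auto simp: supported_def not_less_eq_eq not_less)
  qed
  have "unit_vec k \<in> cseq.span {model_br r x y |x y. x \<in> U \<and> y \<in> nil_space}"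
    if "k \<in> {Suc a..<2*r+5}" for k
  proof -
    from that have "k \<noteq> 0" by simp
    then obtain j where j: "k = Suc j" using not0_implies_Suc by blast
    have jU: "unit_vec j \<in> U" using assms(2) that j by auto
    have 1: "unit_vec 1 \<in> nil_space" by simp
    have "model_br r (unit_vec j) (unit_vec 1) \<in> cseq.span {model_br r x y |x y. x \<in> U \<and> y \<in> nil_space}"
      using jU 1 by (intro cseq.span_base) blast
    moreover have "model_br r (unit_vec j) (unit_vec 1) = - unit_vec k"
      using nil.br_anti[of "unit_vec j" "unit_vec 1"] br_X_Y[of j] j jU that assms(1,3) 1 by auto
    ultimately show ?thesis using cseq.span_neg by fastforce
  qed
  then have "cseq.span (unit_vec ` {Suc a..<2*r+5})
      \<subseteq> cseq.span {model_br r x y |x y. x \<in> U \<and> y \<in> nil_space}"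
    by (intro cseq.span_minimal) auto
  then show "supported {Suc a..<2*r+5} \<subseteq> cseq.span {model_br r x y |x y. x \<in> U \<and> y \<in> nil_space}"
    by (simp add: span_unit_vec)
qed (rule subspace_supported)

text \<open>The indices 0 and 1 both give the whole algebra, hence the double \<open>Suc\<close>.
  The first bracket removes X, Z and Y_0, each later one a single Y_i; the bracket with Y_0 shifts
  by r and so stays inside.\<close>

lemma nil_lower_central: "nil.lower_central (Suc (Suc k)) = supported {k + 5..<2*r+5}"
proof (induction k)
  case 0
  have "nil.bracket_space nil_space nil_space = supported {Suc 4..<2*r+5}"
    by (rule nil_bracket_space) (auto simp: supported_def model_br_def)
  then show ?case by simp
next
  case (Suc k)
  have "nil.bracket_space (supported {k + 5..<2*r+5}) nil_space = supported {Suc (k + 5)..<2*r+5}"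
  proof (rule nil_bracket_space)
    show "supported {k + 5..<2*r+5} \<subseteq> nil_space" by (rule supported_mono) auto
    show "model_br r u v j = 0"
      if "u \<in> supported {k + 5..<2*r+5}" "v \<in> nil_space" "j \<le> k + 5" for u v j
    proof -
      have u: "u i = 0" if "i < k + 5" for i
        using that \<open>u \<in> _\<close> by (simp add: supported_def)
      have v: "v 0 = 0" "v 2 = 0"
        using \<open>v \<in> _\<close> by (simp_all add: supported_def)
      have "u (j - r) = 0" if "r + 4 < j" using that u r_ge_2 \<open>j \<le> _\<close> by simp
      moreover have "u (j - 1) = 0" if "4 < j" using that u \<open>j \<le> _\<close> by simp
      ultimately show ?thesis by (simp add: model_br_def u v)
    qed
  qed auto
  moreover have "nil.lower_central (Suc (Suc (Suc k))) =
      nil.bracket_space (nil.lower_central (Suc (Suc k))) nil_space"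
    by simp
  ultimately show ?case using Suc.IH by simp
qed

text \<open>The dimension is 2r + 3, from X, Z and the 2r + 1 vectors Y_i. The last nonzero term of
  the series, at index 2r + 1, is the line of Y_(2r).\<close>

lemma nil_quasi_filiform: "nil.quasi_filiform"
  unfolding nil.quasi_filiform_def
proof (intro conjI exI)
  have fin: "finite ({..<2*r+5} - {0, 2})" by simp
  show "nil.finite_dim"
    unfolding nil.finite_dim_def using span_unit_vec[OF fin] fin by (metis finite_imageI)
  have 0: "nil.lower_central (2*r+1 + 1) = {0}"
    using nil_lower_central[of "2*r"] by (simp add: supported_0_iff)
  then show "nil.nilpotent" unfolding nil.nilpotent_def by blast
  have idx: "2*r+1 = Suc (Suc (2*r-1))" using r_ge_2 by simp
  have "nil.lower_central (2*r+1) \<noteq> {0}"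
    unfolding idx nil_lower_central supported_0_iff using r_ge_2 by simp
  with 0 show "nil.has_nilindex (2*r+1)" by (simp add: nil.has_nilindex_def)
  show "cseq.dim nil_space = 2*r+1 + 2"
    by (subst dim_supported[OF fin], subst card_Diff_subset) auto
qed

text \<open>An element with nonzero T-coordinate (\<open>h = 0\<close>) or S-coordinate
  (\<open>h = 2\<close>) scales the X- or Z-coordinate \<open>Suc h\<close> by a nonzero factor, so
  iterated brackets with it never die out.\<close>

lemma nilpotent_ideal_subset:
  assumes I: "lie_ideal I" and nilp: "lie_algebra.nilpotent cscale I (model_br r)"
  shows "I \<subseteq> nil_space"
proof
  fix x assume x: "x \<in> I"
  interpret I: lie_algebra cscale I "model_br r" by (rule ideal_lie_algebra[OF I])
  have ILL: "I \<subseteq> model_space r" using I by (simp add: lie_ideal_def)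
  have "x h = 0" if h: "h \<in> {0, 2}" for h
  proof (rule ccontr)
    assume xh: "x h \<noteq> 0"
    have br_e: "model_br r u v (Suc h) = u h * v (Suc h) - v h * u (Suc h)" for u v
      using h by (elim insertE emptyE) (simp_all add: model_br_def)
    have br_h: "model_br r u v h = 0" for u v
      using h by (auto simp: model_br_def)
    have base: "\<exists>y\<in>I. y h = 0 \<and> y (Suc h) \<noteq> 0"
    proof (intro bexI conjI)
      show "model_br r (unit_vec (Suc h)) x \<in> I"
        using I x h by (auto simp: lie_ideal_def)
      show "model_br r (unit_vec (Suc h)) x (Suc h) \<noteq> 0"
        unfolding br_e using xh by (simp add: unit_vec_def)
    qed (rule br_h)
    \<comment> \<open>Carrying \<open>y h = 0\<close> along makes the bracket with \<open>x\<close>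
      multiply the coordinate \<open>Suc h\<close> by exactly \<open>- x h\<close>.\<close>
    have "\<exists>y\<in>I.lower_central k. y h = 0 \<and> y (Suc h) \<noteq> 0" for k
    proof (induction k)
      case 0 then show ?case using base by simp
    next
      case (Suc k)
      then obtain y where y: "y \<in> I.lower_central k" "y h = 0" "y (Suc h) \<noteq> 0" by blast
      then have "model_br r y x \<in> I.bracket_space (I.lower_central k) I"
        unfolding I.bracket_space_def using x by (intro cseq.span_base) blast
      moreover have "model_br r y x (Suc h) \<noteq> 0"
        unfolding br_e using y xh by simp
      ultimately show ?case using base br_h by auto
    qed
    moreover obtain k where "I.lower_central k = {0}" using nilp unfolding I.nilpotent_def by blast
    ultimately obtain y where "y \<in> {0 :: nat \<Rightarrow> complex}" "y (Suc h) \<noteq> 0" by metis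
    then show False by simp
  qed
  then show "x \<in> nil_space" using x ILL by (auto simp: supported_def)
qed

lemma nilradical_model: "nilradical = nil_space"
proof
  show "nilradical \<subseteq> nil_space"
    unfolding nilradical_def using nilpotent_ideal_subset
    by (intro cseq.span_minimal subspace_supported) blast
  have "nil.nilpotent" using nil_quasi_filiform by (simp add: nil.quasi_filiform_def)
  then show "nil_space \<subseteq> nilradical"
    unfolding nilradical_def using nil_ideal by (intro subsetI cseq.span_base) blast
qed

subsection \<open>Cocycles\<close>

text \<open>The coefficient of t^s in u((1-p)t) v(pt), with sequences read as power series.\<close>

definition conv :: "complex \<Rightarrow> nat \<Rightarrow> (nat \<Rightarrow> complex) \<Rightarrow> (nat \<Rightarrow> complex) \<Rightarrow> complex" where
  "conv p s u v = (\<Sum>i\<le>s. (1 - p) ^ i * p ^ (s - i) * u i * v (s - i))"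

text \<open>The action of T on Y-coordinates.\<close>

definition weighted :: "(nat \<Rightarrow> complex) \<Rightarrow> nat \<Rightarrow> complex" where
  "weighted u i = of_nat (r + i) * u i"

text \<open>The action of X on Y-coordinates, that is, multiplication by t.\<close>

definition shifted :: "(nat \<Rightarrow> complex) \<Rightarrow> nat \<Rightarrow> complex" where
  "shifted u i = (if i = 0 then 0 else u (i - 1))"

definition ypart :: "(nat \<Rightarrow> complex) \<Rightarrow> nat \<Rightarrow> complex" where
  "ypart v i = v (4 + i)"

definition alt_conv :: "complex \<Rightarrow> nat \<Rightarrow> (nat \<Rightarrow> complex) \<Rightarrow> (nat \<Rightarrow> complex) \<Rightarrow> complex" where
  "alt_conv p s x y = conv p s (ypart x) (ypart y) - conv p s (ypart y) (ypart x)"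

definition cocycle ::
  "complex \<Rightarrow> (nat \<Rightarrow> complex) \<Rightarrow> (nat \<Rightarrow> complex) \<Rightarrow> nat \<Rightarrow> complex" where
  "cocycle p x y = (\<lambda>k. if x \<in> model_space r \<and> y \<in> model_space r \<and> r + 4 \<le> k \<and> k < 2*r+5
     then alt_conv p (k - (r + 4)) x y else 0)"

lemma conv_0: "conv p 0 u v = u 0 * v 0"
  by (simp add: conv_def)

text \<open>The weights r + i and r + (s - i) of the two factors add up to 2r + s, the weight of the
  target Y_(r+s).\<close>

lemma conv_weighted_right:
  "conv p s u (weighted v) = of_nat (2*r+s) * conv p s u v - conv p s (weighted u) v"
proof -
  have "conv p s (weighted u) v + conv p s u (weighted v) =
    (\<Sum>i\<le>s. of_nat (2*r+s) * ((1 - p) ^ i * p ^ (s - i) * u i * v (s - i)))"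
    unfolding conv_def sum.distrib[symmetric]
  proof (rule sum.cong)
    fix i assume "i \<in> {..s}"
    then have "(of_nat (2*r+s) :: complex) = of_nat (r + i) + of_nat (r + (s - i))"
      unfolding of_nat_add[symmetric] by (intro arg_cong[of _ _ of_nat]) auto
    then show "(1 - p) ^ i * p ^ (s - i) * weighted u i * v (s - i)
        + (1 - p) ^ i * p ^ (s - i) * u i * weighted v (s - i)
      = of_nat (2*r+s) * ((1 - p) ^ i * p ^ (s - i) * u i * v (s - i))"
      unfolding weighted_def by (simp only: distrib_right) (simp add: mult_ac)
  qed simp
  also have "\<dots> = of_nat (2*r+s) * conv p s u v"
    by (simp add: conv_def sum_distrib_left)
  finally show ?thesis by (simp add: eq_diff_eq add.commute)
qed

text \<open>Here and in \<open>conv_shifted_right\<close> the factors 1 - p and p appear; their sum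
  1 is what makes the cochain compatible with X.\<close>

lemma conv_shifted_left:
  "conv p s (shifted u) v = (if s = 0 then 0 else (1 - p) * conv p (s - 1) u v)"
proof (cases s)
  case (Suc t)
  then show ?thesis
    by (simp add: conv_def shifted_def sum.atMost_Suc_shift sum_distrib_left mult_ac
        del: sum.atMost_Suc)
qed (simp add: conv_def shifted_def)

lemma conv_shifted_right:
  "conv p s u (shifted v) = (if s = 0 then 0 else p * conv p (s - 1) u v)"
proof (cases s)
  case (Suc t)
  have "(\<Sum>i\<le>t. (1 - p) ^ i * p ^ (Suc t - i) * u i * shifted v (Suc t - i)) =
      (\<Sum>i\<le>t. p * ((1 - p) ^ i * p ^ (t - i) * u i * v (t - i)))"
    by (rule sum.cong) (auto simp: shifted_def Suc_diff_le mult_ac)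
  with Suc show ?thesis by (simp add: conv_def shifted_def sum_distrib_left)
qed (simp add: conv_def shifted_def)

text \<open>Up to index r the Y_0-term of the bracket is absent, and \<open>conv p s\<close> with
  \<open>s \<le> r\<close> sees only these indices.\<close>

lemma ypart_br:
  assumes "i \<le> r"
  shows "ypart (model_br r x y) i =
    (x 0 * weighted (ypart y) i - y 0 * weighted (ypart x) i)
    + (x 1 * shifted (ypart y) i - y 1 * shifted (ypart x) i)"
proof (cases i)
  case 0
  then show ?thesis by (simp add: ypart_def weighted_def shifted_def model_br_def algebra_simps)
next
  case (Suc j)
  then have "4 + i - 1 = 4 + j" by simp
  with Suc assms show ?thesis
    by (simp add: ypart_def weighted_def shifted_def model_br_def algebra_simps)
qed

lemma conv_cong:
  assumes "\<And>i. i \<le> s \<Longrightarrow> u i = u' i" "\<And>i. i \<le> s \<Longrightarrow> v i = v' i"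
  shows "conv p s u v = conv p s u' v'"
  unfolding conv_def using assms by (intro sum.cong) auto

lemma conv_br_left:
  assumes "s \<le> r"
  shows "conv p s (ypart (model_br r x y)) v =
    x 0 * conv p s (weighted (ypart y)) v - y 0 * conv p s (weighted (ypart x)) v
    + (x 1 * conv p s (shifted (ypart y)) v - y 1 * conv p s (shifted (ypart x)) v)"
proof -
  have "conv p s (ypart (model_br r x y)) v = conv p s (\<lambda>i.
    (x 0 * weighted (ypart y) i - y 0 * weighted (ypart x) i)
    + (x 1 * shifted (ypart y) i - y 1 * shifted (ypart x) i)) v"
    by (rule conv_cong) (use ypart_br assms in auto)
  then show ?thesis
    by (simp add: conv_def sum_distrib_left algebra_simps sum.distrib sum_subtractf)
qed

lemma conv_br_right:
  assumes "s \<le> r"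
  shows "conv p s v (ypart (model_br r x y)) =
    x 0 * conv p s v (weighted (ypart y)) - y 0 * conv p s v (weighted (ypart x))
    + (x 1 * conv p s v (shifted (ypart y)) - y 1 * conv p s v (shifted (ypart x)))"
proof -
  have "conv p s v (ypart (model_br r x y)) = conv p s v (\<lambda>i.
    (x 0 * weighted (ypart y) i - y 0 * weighted (ypart x) i)
    + (x 1 * shifted (ypart y) i - y 1 * shifted (ypart x) i))"
    by (rule conv_cong) (use ypart_br assms in auto)
  then show ?thesis
    by (simp add: conv_def sum_distrib_left algebra_simps sum.distrib sum_subtractf)
qed

lemma br_cocycle:
  assumes L: "y \<in> model_space r" "z \<in> model_space r" and "s \<le> r"
  shows "model_br r x (cocycle p y z) (r + 4 + s) =
    of_nat (2*r+s) * x 0 * alt_conv p s y z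
    + (if s = 0 then 0 else x 1 * alt_conv p (s - 1) y z)"
proof -
  let ?c = "cocycle p y z"
  have c: "?c 0 = 0" "?c 1 = 0" "?c 4 = 0" using r_ge_2 by (simp_all add: cocycle_def)
  have 1: "?c (r + 4 + s) = alt_conv p s y z" using assms by (simp add: cocycle_def)
  have 2: "?c (r + 4 + s - 1) = (if s = 0 then 0 else alt_conv p (s - 1) y z)"
    using assms by (cases s) (simp_all add: cocycle_def)
  \<comment> \<open>This is the coordinate multiplied by \<open>x 4\<close>. Its index 4 + s reaches
    the support of the cocycle only for s = r, where the value is \<open>alt_conv p 0\<close>, zero
    by symmetry of \<open>conv p 0\<close>.\<close>
  have 3: "?c (r + 4 + s - r) = 0"
  proof (cases "s = r")
    case True
    then show ?thesis using L by (simp add: cocycle_def alt_conv_def conv_0 mult.commute)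
  qed (use assms in \<open>simp add: cocycle_def\<close>)
  have k: "r + 4 + s \<noteq> 1" "r + 4 + s \<noteq> 3" "4 \<le> r + 4 + s" "r + 4 + s < 2*r+5"
    "4 < r + 4 + s" "r + (r + 4 + s - 4) = 2*r+s"
    using assms r_ge_2 by simp_all
  show ?thesis
    unfolding model_br_def c 1 2 3 using k by (simp del: of_nat_add of_nat_mult)
qed

lemma br_cocycle_0:
  assumes "k < r + 4 \<or> 2*r+5 \<le> k"
  shows "model_br r x (cocycle p y z) k = 0"
  using assms r_ge_2 by (auto simp: model_br_def cocycle_def)

lemma cocycle_in_cocycles2: "cocycle p \<in> cocycles2"
proof -
  have "cocycle p \<in> cochains2"
  proof -
    have add: "conv p s (ypart (x + y)) v = conv p s (ypart x) v + conv p s (ypart y) v"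
      "conv p s v (ypart (x + y)) = conv p s v (ypart x) + conv p s v (ypart y)"
      "conv p s (ypart (cscale c x)) v = c * conv p s (ypart x) v"
      "conv p s v (ypart (cscale c x)) = c * conv p s v (ypart x)" for s x y v c
      by (simp_all add: conv_def ypart_def cscale_def sum.distrib sum_distrib_left algebra_simps)
    show ?thesis
      unfolding cochains2_def bilinear_on_def linear_on_def
      using cseq.subspace_add[OF subspace_L] cseq.subspace_scale[OF subspace_L]
      by (auto simp: cocycle_def alt_conv_def add fun_eq_iff supported_def[of "{..<2*r+5}"] )
        (auto simp: cscale_def alt_conv_def algebra_simps)
  qed
  moreover have "d2 (cocycle p) x y z k = 0" for x y z k
  proof (cases "x \<in> model_space r \<and> y \<in> model_space r \<and> z \<in> model_space r")
    case True
    then have L: "x \<in> model_space r" "y \<in> model_space r" "z \<in> model_space r" by auto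
    show ?thesis
    proof (cases "k < r + 4 \<or> 2*r+5 \<le> k")
      case True
      then show ?thesis
        using L br_cocycle_0[OF True] by (auto simp: d2_def) (auto simp: cocycle_def)
    next
      case False
      then have "k = r + 4 + (k - (r + 4))" "k - (r + 4) \<le> r" by arith+
      then obtain s where k: "k = r + 4 + s" "s \<le> r" by blast
      have c: "cocycle p u v k = alt_conv p s u v" if "u \<in> model_space r" "v \<in> model_space r" for u v
        using that k by (simp add: cocycle_def)
      have "d2 (cocycle p) x y z k =
          model_br r x (cocycle p y z) k - model_br r y (cocycle p x z) k
          + model_br r z (cocycle p x y) k
          - alt_conv p s (model_br r x y) z + alt_conv p s (model_br r x z) y
          - alt_conv p s (model_br r y z) x"
        using L br_closed by (simp add: d2_def c)
      \<comment> \<open>The T-terms cancel by homogeneity and the X-terms because (1 - p) + p = 1;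
        for s = 0 there are no X-terms.\<close>
      also have "\<dots> = 0"
        unfolding k(1) br_cocycle[OF L(2,3) k(2)] br_cocycle[OF L(1,3) k(2)]
          br_cocycle[OF L(1,2) k(2)]
        by (cases "s = 0")
          (simp_all add: alt_conv_def conv_br_left conv_br_right k(2)
            conv_weighted_right conv_shifted_left conv_shifted_right algebra_simps)
      finally show ?thesis .
    qed
  qed (auto simp: d2_def)
  ultimately show ?thesis by (simp add: cocycles2_def fun_eq_iff)
qed

section \<open>Linear independence of the cocycle classes\<close>

lemma cocycle_at_units:
  assumes "2 \<le> j" "j < r"
  shows "cocycle p (unit_vec 5) (unit_vec (4 + j)) (r + 5 + j) = (1 - p) * p ^ j - (1 - p) ^ j * p"
proof -
  have y: "ypart (unit_vec 5) = unit_vec 1" "ypart (unit_vec (4 + j)) = unit_vec j"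
    by (auto simp: ypart_def unit_vec_def fun_eq_iff)
  have "conv p (1 + j) (unit_vec 1) (unit_vec j) = (\<Sum>i\<le>1+j. if i = 1 then (1 - p) * p ^ j else 0)"
    unfolding conv_def by (rule sum.cong) (auto simp: unit_vec_def)
  moreover have "conv p (1 + j) (unit_vec j) (unit_vec 1) =
      (\<Sum>i\<le>1+j. if i = j then (1 - p) ^ j * p else 0)"
    unfolding conv_def by (rule sum.cong) (auto simp: unit_vec_def)
  moreover have "r + 5 + j - (r + 4) = 1 + j" by simp
  ultimately show ?thesis
    using assms by (simp add: cocycle_def alt_conv_def y)
qed

lemma coboundary_at_units:
  assumes f: "f \<in> cochains1" and j: "2 \<le> j" "j < r"
  shows "d1 f (unit_vec 5) (unit_vec (4 + j)) (r + 5 + j) = 0"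
proof -
  have "f 0 = 0" using linear_on_sum[of f "{}" "\<lambda>_. 0"] f by (simp add: cochains1_def)
  moreover have "model_br r (unit_vec 5) (unit_vec (4 + j)) = 0"
    using j by (simp add: model_br_def fun_eq_iff) (simp add: unit_vec_def)
  \<comment> \<open>For i \<ge> 1, Y_i has nonzero brackets only with T, X and Y_0, which land on
    Y_i, Y_(i+1) and Y_(r+i). The excluded values of \<open>a\<close> are those reaching Y_(r+1+j)
    in this way.\<close>
  moreover have "model_br r (unit_vec a) v (r + 5 + j) = 0"
    if "5 \<le> a" "a \<noteq> 5 + j" "a \<noteq> r + 4 + j" "a \<noteq> r + 5 + j" for a v
  proof -
    have "unit_vec a 0 = 0" "unit_vec a 1 = 0" "unit_vec a 4 = 0" "unit_vec a (r + 5 + j) = 0"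
      "unit_vec a (r + 5 + j - 1) = 0" "unit_vec a (r + 5 + j - r) = 0"
      using that by (auto simp: unit_vec_def)
    then show ?thesis by (simp add: model_br_def)
  qed
  ultimately show ?thesis
    using j r_ge_2 by (simp add: d1_def)
qed

text \<open>A vanishing combination of classes gives one linear equation for each exponent i \<le>
  2m, hence one for each polynomial of degree at most 2m. A polynomial vanishing at all nodes p and
  1 - p except one \<open>p t0\<close> isolates \<open>c t0\<close>.\<close>

lemma card_le_dim_H2_model:
  assumes r: "r = 2*m+2"
  shows "m \<le> dim_H2"
proof -
  \<comment> \<open>All p are positive and all 1 - p negative integers, so the nodes are pairwise
    distinct and nonzero.\<close>
  define p :: "nat \<Rightarrow> complex" where "p t = of_nat (t + 2)" for t
  have q: "1 - p t = - of_nat (t + 1)" for t by (simp add: p_def)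
  have "card {..<m} \<le> dim_H2"
  proof (rule card_le_dim_H2[OF finite_dim_model])
    fix c f assume f: "f \<in> cochains1"
      and eq: "\<And>x y. (\<Sum>t<m. cscale (c t) (cocycle (p t) x y)) = d1 f x y"
    have pow: "(\<Sum>t<m. c t * p t * (1 - p t) * (p t ^ i - (1 - p t) ^ i)) = 0" if "i \<le> 2*m" for i
    proof (cases "i = 0")
      case False
      \<comment> \<open>The pair (Y_1, Y_j) with j = i + 1 yields the equation for exponent i after
        factoring out p (1 - p); \<open>r = 2*m+2\<close> admits every i up to 2m.\<close>
      then have j: "2 \<le> Suc i" "Suc i < r" using that r by simp_all
      have "(\<Sum>t<m. c t * ((1 - p t) * p t ^ Suc i - (1 - p t) ^ Suc i * p t)) = 0"
        using fun_cong[OF eq[of "unit_vec 5" "unit_vec (4 + Suc i)"], of "r + 5 + Suc i"]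
        unfolding sum_cscale_apply cocycle_at_units[OF j] coboundary_at_units[OF f j] .
      then show ?thesis by (simp add: algebra_simps)
    qed simp
    have poly: "(\<Sum>t<m. c t * p t * (1 - p t) * (poly P (p t) - poly P (1 - p t))) = 0"
      if P: "degree P \<le> 2*m" for P
    proof -
      have "(\<Sum>t<m. c t * p t * (1 - p t) * (poly P (p t) - poly P (1 - p t))) =
          (\<Sum>t<m. \<Sum>i\<le>degree P. coeff P i * (c t * p t * (1 - p t) * (p t ^ i - (1 - p t) ^ i)))"
        by (simp add: poly_altdef sum_subtractf[symmetric] sum_distrib_left algebra_simps)
      also have "\<dots> = (\<Sum>i\<le>degree P. coeff P i *
          (\<Sum>t<m. c t * p t * (1 - p t) * (p t ^ i - (1 - p t) ^ i)))"
        by (subst sum.swap) (simp add: sum_distrib_left)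
      also have "\<dots> = 0" using P by (intro sum.neutral) (simp add: pow)
      finally show ?thesis .
    qed
    show "\<forall>t\<in>{..<m}. c t = 0"
    proof
      fix t0 assume t0: "t0 \<in> {..<m}"
      \<comment> \<open>All nodes except \<open>p t0\<close>: at most 2m roots, so the degree bound
        is met.\<close>
      define A where "A = p ` ({..<m} - {t0}) \<union> (\<lambda>t. 1 - p t) ` {..<m}"
      define P where "P = (\<Prod>a\<in>A. [:- a, 1:])"
      have finA: "finite A" by (simp add: A_def)
      have "card A \<le> card ({..<m} - {t0}) + card {..<m}"
        unfolding A_def by (intro order_trans[OF card_Un_le] add_mono card_image_le) auto
      also have "\<dots> \<le> 2*m" using t0 by simp
      finally have deg: "degree P \<le> 2*m"
        using degree_prod_sum_le[OF finA, of "\<lambda>a. [:- a, 1:]"] by (simp add: P_def)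
      have root: "poly P a = 0 \<longleftrightarrow> a \<in> A" for a
        using finA by (auto simp: P_def poly_prod)
      have root_p: "poly P (p t) = 0" if "t < m" "t \<noteq> t0" for t
        unfolding root A_def using that by blast
      have root_q: "poly P (1 - p t) = 0" if "t < m" for t
        unfolding root A_def using that by blast
      have neq: "p t0 \<noteq> 1 - p t" for t
      proof
        assume eq: "p t0 = 1 - p t"
        have "(of_nat (t0 + 2 + (t + 1)) :: complex) = p t0 - (1 - p t)" by (simp add: p_def)
        then have "(of_nat (t0 + 2 + (t + 1)) :: complex) = 0" using eq by simp
        then show False by (simp only: of_nat_eq_0_iff)
      qed
      have "p t0 \<notin> A" using neq by (auto simp: A_def p_def)
      then have P0: "poly P (p t0) \<noteq> 0" by (simp add: root)
      have "(\<Sum>t<m. c t * p t * (1 - p t) * (poly P (p t) - poly P (1 - p t))) =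
          (\<Sum>t\<in>{t0}. c t * p t * (1 - p t) * (poly P (p t) - poly P (1 - p t)))"
        using t0 by (intro sum.mono_neutral_right) (auto simp: root_p root_q)
      also have "\<dots> = c t0 * p t0 * (1 - p t0) * poly P (p t0)"
        using t0 by (simp add: root_q)
      finally have "c t0 * p t0 * (1 - p t0) * poly P (p t0) = 0" using poly[OF deg] by simp
      moreover have "p t0 \<noteq> 0"
        unfolding p_def of_nat_eq_0_iff by simp
      moreover have "1 - p t0 \<noteq> 0"
        unfolding q neg_equal_0_iff_equal of_nat_eq_0_iff by simp
      ultimately show "c t0 = 0" using P0 by simp
    qed
  qed (auto intro: cocycle_in_cocycles2)
  then show ?thesis by simp
qed

end

theorem proposition1:
  fixes m :: nat
  assumes "m > 0"
  shows "\<exists>(L :: (nat \<Rightarrow> complex) set) br.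
    lie_algebra cscale L br \<and>
    lie_algebra.finite_dim cscale L \<and>
    lie_algebra.complete_lie cscale L br \<and>
    lie_algebra.quasi_filiform cscale (lie_algebra.nilradical cscale L br) br \<and>
    lie_algebra.dim_H2 cscale L br \<ge> m"
proof -
  interpret model "2*m+2" by unfold_locales simp
  show ?thesis
    using lie_algebra_axioms finite_dim_model complete_model nil_quasi_filiform
      card_le_dim_H2_model[OF refl] nilradical_model
    by metis
qed

end
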